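(* For each of the following 44 symmetrizable hyperbolic root systems $\Phi$ of rank $3$ with fundamental roots $\alpha_1,\alpha_2,\alpha_3$, and each listed fundamental root $\alpha$, the subsystem $Z_s(\alpha)_{\mathrm{re}}$ has the stated basis. In each row, "$(n_1,n_2,n_3);(b_{12},b_{13},b_{23})$" specifies $\Phi$ by $|\alpha_i|^2=n_i$ and $(\alpha_i,\alpha_j)=-b_{ij}/2$. A root $k_1\alpha_1+k_2\alpha_2+k_3\alpha_3$ is written $(k_1,k_2,k_3)$. An entry "$\alpha_i$: $\beta_1,\beta_2\ [p,q]$" means that $\{\beta_1,\beta_2\}$ is a basis of $Z_s(\alpha_i)_{\mathrm{re}}$ with $\langle\beta_1,\beta_2^\vee\rangle=-p$, $\langle\beta_2,\beta_1^\vee\rangle=-q$; an entry "$\alpha_i$: $\beta$" means $Z_s(\alpha_i)_{\mathrm{re}}=\{\pm\beta\}$; an entry "$\alpha_i$: $\varnothing$" means $Z_s(\alpha_i)_{\mathrm{re}}=\varnothing$. 1. $(2,1,2);(2,2,2)$. $\alpha_1$: $(1,2,0),(3,2,4)$ $[10,10]$; $\alpha_2$: $\varnothing$. 2. $(1,2,1);(2,1,2)$. $\alpha_1$: $\varnothing$; $\alpha_2$: $(2,1,0),(0,1,2)$ $[4,4]$. 3. $(3,1,3);(3,3,3)$. $\alpha_1$: $(1,2,0),(3,2,4)$ $[34,34]$; $\alpha_2$: $(2,3,0),(0,3,2)$ $[10,10]$. 4. $(1,3,1);(3,1,3)$. $\alpha_1$: $(3,2,0),(9,2,12)$ $[34,34]$;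 $\alpha_2$: $(2,1,0),(0,1,2)$ $[10,10]$. 5. $(6,2,1);(6,0,2)$. $\alpha_1$: $(0,0,1),(1,2,0)$ $[2,4]$; $\alpha_2$: $(0,1,2),(2,3,0)$ $[2,6]$; $\alpha_3$: $(1,0,0),(1,6,6)$ $[4,4]$. 6. $(1,3,6);(3,0,6)$. $\alpha_1$: $(0,0,1),(3,2,0)$ $[4,2]$; $\alpha_2$: $(2,1,0),(2,3,2)$ $[10,10]$; $\alpha_3$: $(1,0,0),(0,2,1)$ $[1,6]$. 7. $(3,1,2);(3,0,2)$. $\alpha_1$: $(0,0,1),(1,2,0)$ $[4,2]$; $\alpha_2$: $(2,3,0),(2,9,6)$ $[10,10]$; $\alpha_3$: $(1,0,0),(0,2,1)$ $[3,2]$. 8. $(2,6,3);(6,0,6)$. $\alpha_1$: $(0,0,1),(3,2,0)$ $[2,4]$; $\alpha_2$: $(2,1,0),(0,1,2)$ $[2,6]$; $\alpha_3$: $(1,0,0),(1,2,2)$ $[4,4]$. 9. $(9,3,1);(9,0,3)$. $\alpha_1$: $(0,0,1),(1,2,0)$ $[2,6]$; $\alpha_2$: $(0,1,2),(2,3,0)$ $[2,18]$; $\alpha_3$: $(1,0,0),(0,2,3)$ $[6,2]$. 10. $(3,1,3);(3,0,3)$. $\alpha_1$: $(0,0,1),(1,2,0)$ $[6,2]$; $\alpha_2$: $(2,3,0),(0,3,2)$ $[6,6]$. 11. $(1,3,1);(3,0,3)$. $\alpha_1$: $(0,0,1),(3,2,0)$ $[2,6]$; $\alpha_2$: $(2,1,0),(0,1,2)$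 $[6,6]$. 12. $(1,1,1);(1,2,1)$. $\alpha_2$: $\varnothing$. 13. $(1,1,1);(1,2,2)$. $\alpha_1$: $\varnothing$; $\alpha_3$: $\varnothing$. 14. $(1,1,4);(1,4,4)$. $\alpha_1$: $\varnothing$; $\alpha_3$: $\varnothing$. 15. $(4,4,1);(4,4,4)$. $\alpha_1$: $\varnothing$; $\alpha_3$: $\varnothing$. 16. $(2,4,1);(4,2,4)$. $\alpha_1$: $(1,0,2),(7,6,2)$ $[34,34]$; $\alpha_2$: $(2,1,0)$; $\alpha_3$: $\varnothing$. 17. $(2,1,2);(2,4,2)$. $\alpha_1$: $(1,2,0)$; $\alpha_2$: $\varnothing$. 18. $(1,2,1);(2,2,2)$. $\alpha_1$: $\varnothing$; $\alpha_2$: $(2,1,0),(0,1,2)$ $[6,6]$. 19. $(1,1,1);(2,2,2)$. $\alpha_1$: $\varnothing$. 20. $(3,3,1);(6,3,3)$. $\alpha_1$: $(1,0,2)$; $\alpha_3$: $(2,0,3),(0,2,3)$ $[14,14]$. 21. $(1,1,3);(2,3,3)$. $\alpha_1$: $(3,0,2)$; $\alpha_3$: $(2,0,1),(0,2,1)$ $[14,14]$. 22. $(4,4,1);(8,4,4)$. $\alpha_1$: $\varnothing$; $\alpha_3$: $\varnothing$. 23. $(1,1,4);(2,4,4)$. $\alpha_1$: $\varnothing$; $\alpha_3$: $\varnothing$. 24. $(1,1,1);(2,0,1)$. $\alpha_1$: $(0,0,1)$; $\alpha_3$: $(1,0,0)$. 25. $(1,4,4);(4,0,4)$. $\alpha_1$: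 $(0,0,1)$; $\alpha_3$: $(1,0,0)$. 26. $(4,1,1);(4,0,1)$. $\alpha_1$: $(0,0,1)$; $\alpha_3$: $(1,0,0)$. 27. $(1,1,2);(2,0,2)$. $\alpha_1$: $(0,0,1)$; $\alpha_2$: $\varnothing$; $\alpha_3$: $(1,0,0),(0,2,1)$ $[2,4]$. 28. $(2,2,1);(4,0,2)$. $\alpha_1$: $(0,0,1)$; $\alpha_2$: $(0,1,2)$; $\alpha_3$: $(1,0,0),(1,4,4)$ $[6,6]$. 29. $(8,4,1);(8,0,4)$. $\alpha_1$: $(0,0,1),(1,2,0)$ $[1,8]$; $\alpha_2$: $\varnothing$; $\alpha_3$: $(1,0,0)$. 30. $(1,2,8);(2,0,8)$. $\alpha_1$: $(0,0,1),(8,8,1)$ $[6,6]$; $\alpha_2$: $(2,1,0)$; $\alpha_3$: $(1,0,0)$. 31. $(4,1,2);(4,0,2)$. $\alpha_1$: $(0,0,1)$; $\alpha_2$: $\varnothing$; $\alpha_3$: $(1,0,0),(0,2,1)$ $[4,2]$. 32. $(1,4,2);(4,0,4)$. $\alpha_1$: $(0,0,1)$; $\alpha_2$: $(0,1,2)$; $\alpha_3$: $(1,0,0),(1,2,2)$ $[6,6]$. 33. $(1,1,1);(2,0,2)$. $\alpha_1$: $(0,0,1)$; $\alpha_2$: $\varnothing$. 34. $(3,3,1);(6,0,3)$. $\alpha_1$: $(0,0,1)$; $\alpha_2$: $(0,1,2)$; $\alpha_3$: $(1,0,0),(0,2,3)$ $[4,4]$. 35. $(1,1,3);(2,0,3)$.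 $\alpha_1$: $(0,0,1)$; $\alpha_2$: $(0,3,2)$; $\alpha_3$: $(1,0,0),(0,2,1)$ $[4,4]$. 36. $(4,4,1);(8,0,4)$. $\alpha_1$: $(0,0,1)$; $\alpha_2$: $\varnothing$; $\alpha_3$: $(1,0,0)$. 37. $(1,1,4);(2,0,4)$. $\alpha_1$: $(0,0,1)$; $\alpha_2$: $\varnothing$; $\alpha_3$: $(1,0,0)$. 38. $(1,4,12);(4,0,12)$. $\alpha_1$: $(0,0,1)$; $\alpha_2$: $(0,3,2)$; $\alpha_3$: $(1,0,0),(0,2,1)$ $[2,8]$. 39. $(12,3,1);(12,0,3)$. $\alpha_1$: $(0,0,1)$; $\alpha_2$: $(0,1,2)$; $\alpha_3$: $(1,0,0),(0,2,3)$ $[8,2]$. 40. $(3,1,4);(3,0,4)$. $\alpha_1$: $(0,0,1),(1,2,0)$ $[8,2]$; $\alpha_2$: $(2,3,0)$; $\alpha_3$: $(1,0,0)$. 41. $(4,12,3);(12,0,12)$. $\alpha_1$: $(0,0,1),(3,2,0)$ $[2,8]$; $\alpha_2$: $(2,1,0)$; $\alpha_3$: $(1,0,0)$. 42. $(16,4,1);(16,0,4)$. $\alpha_1$: $(0,0,1)$; $\alpha_2$: $\varnothing$; $\alpha_3$: $(1,0,0)$. 43. $(4,1,4);(4,0,4)$. $\alpha_1$: $(0,0,1)$; $\alpha_2$: $\varnothing$. 44. $(1,4,1);(4,0,4)$. $\alpha_1$: $(0,0,1)$; $\alpha_2$: $\varnothing$.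
   Context: Given $(n_i)$ and $(b_{ij})$, $\Phi$ is the Kac–Moody root system of the generalized Cartan matrix (GCM) with off-diagonal entries $\langle\alpha_i,\alpha_j^\vee\rangle=2(\alpha_i,\alpha_j)/(\alpha_j,\alpha_j)$, where $(\cdot,\cdot)$ is the symmetric bilinear form on $\mathbb R^3$ with the given values on fundamental roots. All listed systems are of hyperbolic type. $\Phi_{\mathrm{re}}$ is the set of real roots. In hyperbolic type it is known that a nonzero integer vector $\beta=\sum k_i\alpha_i$ is a real root iff $|\beta|^2>0$ and $k_i|\alpha_i|^2/|\beta|^2\in\mathbb Z$ for all $i$. For real roots, $\langle\beta,\gamma^\vee\rangle=2(\beta,\gamma)/(\gamma,\gamma)$, and $s_\gamma$ is the reflection in $\gamma$. For $\alpha\in\Phi_{\mathrm{re}}$ and $\beta\in\Phi$ put $C(\alpha,\beta)=(\mathbb Z_{>0}\alpha+\mathbb Z_{>0}\beta)\cap\Phi_{\mathrm{re}}$, $Z(\alpha)=\{\beta\in\Phi\mid C(\alpha,\beta)=\varnothing\}$, $Z_s(\alpha)=Z(\alpha)\cap(-Z(\alpha))$, $Z_s(\alpha)_{\mathrm{re}}=Z_s(\alpha)\cap\Phi_{\mathrm{re}}$. A basis of $Z_s(\alpha)_{\mathrm{re}}$ is a set $\Gamma\subset Z_s(\alpha)_{\mathrm{re}}$ of positive roots that is weakly independent (for each $\gamma\in\Gamma$, $\mathbb Z\gamma\cap\sum_{\gamma'\in\Gamma\setminus\{\gamma\}}\mathbb Z_{\ge0}\gamma'=\{0\}$), whose matrix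 $(\langle\gamma,\gamma'^\vee\rangle)_{\gamma,\gamma'\in\Gamma}$ is a GCM, and such that $Z_s(\alpha)_{\mathrm{re}}=\{w\gamma\mid w\in\langle s_{\gamma'}:\gamma'\in\Gamma\rangle,\ \gamma\in\Gamma\}$. *)

theory Defs
  imports "HOL-Analysis.Analysis"
begin

section \<open>Root systems of symmetrized generalized Cartan matrices\<close>

text \<open>
  A root system is given by the Gram matrix \<open>G\<close> of the symmetric bilinear form on the
  fundamental roots.  The fundamental roots are the standard basis vectors, so a root
  $\sum_i k_i \alpha_i$ is its coordinate vector $(k_i)_i$.
\<close>

definition fund :: "'n \<Rightarrow> real ^ 'n::finite" where
  "fund i = axis i 1"

definition form :: "real ^ 'n ^ 'n \<Rightarrow> real ^ 'n \<Rightarrow> real ^ 'n::finite \<Rightarrow> real" where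
  "form G x y = x \<bullet> (G *v y)"

text \<open>\<open>pairing G x y\<close> is $\langle x, y^\vee\rangle$; it is only meaningful if $(y,y) \neq 0$.\<close>

definition pairing :: "real ^ 'n ^ 'n \<Rightarrow> real ^ 'n \<Rightarrow> real ^ 'n::finite \<Rightarrow> real" where
  "pairing G x y = 2 * form G x y / form G y y"

definition reflection :: "real ^ 'n ^ 'n \<Rightarrow> real ^ 'n \<Rightarrow> real ^ 'n \<Rightarrow> real ^ 'n::finite" where
  "reflection G y x = x - pairing G x y *\<^sub>R y"

text \<open>
  The group $\langle s_\gamma : \gamma \in S\rangle$.  No closure under inverses is needed, since
  reflections are involutions.
\<close>

inductive_set reflection_group ::
  "real ^ 'n ^ 'n \<Rightarrow> (real ^ 'n) set \<Rightarrow> (real ^ 'n \<Rightarrow> real ^ 'n::finite) set"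
  for G :: "real ^ 'n ^ 'n" and S :: "(real ^ 'n) set"
where
  one: "id \<in> reflection_group G S"
| gen: "\<gamma> \<in> S \<Longrightarrow> reflection G \<gamma> \<in> reflection_group G S"
| mult: "v \<in> reflection_group G S \<Longrightarrow> w \<in> reflection_group G S \<Longrightarrow>
    v \<circ> w \<in> reflection_group G S"

definition weyl_group :: "real ^ 'n ^ 'n \<Rightarrow> (real ^ 'n \<Rightarrow> real ^ 'n::finite) set" where
  "weyl_group G = reflection_group G (range fund)"

definition real_roots :: "real ^ 'n ^ 'n \<Rightarrow> (real ^ 'n::finite) set" where
  "real_roots G = {w (fund i) | w i. w \<in> weyl_group G}"

text \<open>
  \<open>indecomposable G J\<close>: the Dynkin diagram restricted to \<open>J\<close> is connected.
\<close>

definition indecomposable :: "real ^ 'n ^ 'n \<Rightarrow> 'n::finite set \<Rightarrow> bool" where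
  "indecomposable G J \<longleftrightarrow>
     (\<forall>J1 J2. J1 \<noteq> {} \<and> J2 \<noteq> {} \<and> J1 \<inter> J2 = {} \<and> J1 \<union> J2 = J \<longrightarrow>
        (\<exists>i\<in>J1. \<exists>j\<in>J2. G $ i $ j \<noteq> 0))"

text \<open>
  The imaginary roots of a Kac--Moody root system, described combinatorially: they are
  $\pm W K$, where $K$ consists of the nonzero $\sum_i k_i \alpha_i$ with nonnegative integer
  coefficients and connected support that pair nonpositively with all simple coroots
  (Kac, Infinite-dimensional Lie algebras, Theorem 5.4).
\<close>

definition imag_cone :: "real ^ 'n ^ 'n \<Rightarrow> (real ^ 'n::finite) set" where
  "imag_cone G = {x. x \<noteq> 0 \<and> (\<forall>i. x $ i \<in> \<nat>) \<and> indecomposable G {i. x $ i \<noteq> 0} \<and>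
     (\<forall>i. pairing G x (fund i) \<le> 0)}"

definition imag_roots :: "real ^ 'n ^ 'n \<Rightarrow> (real ^ 'n::finite) set" where
  "imag_roots G = (\<Union>w\<in>weyl_group G. w ` imag_cone G \<union> (\<lambda>x. - w x) ` imag_cone G)"

definition roots :: "real ^ 'n ^ 'n \<Rightarrow> (real ^ 'n::finite) set" where
  "roots G = real_roots G \<union> imag_roots G"


section \<open>Hyperbolic type\<close>

definition is_GCM :: "('a \<Rightarrow> 'a \<Rightarrow> real) \<Rightarrow> 'a set \<Rightarrow> bool" where
  "is_GCM A S \<longleftrightarrow>
     (\<forall>x\<in>S. A x x = 2) \<and>
     (\<forall>x\<in>S. \<forall>y\<in>S. x \<noteq> y \<longrightarrow>
        A x y \<in> \<int> \<and> A x y \<le> 0 \<and> (A x y = 0 \<longleftrightarrow> A y x = 0))"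

text \<open>
  Finite, affine and indefinite type of the principal submatrix on an indecomposable index
  set \<open>J\<close> (Kac, Corollary 4.3): the vector \<open>u\<close> is supported on \<open>J\<close> and positive there.
\<close>

definition pos_on :: "'n set \<Rightarrow> real ^ 'n::finite \<Rightarrow> bool" where
  "pos_on J u \<longleftrightarrow> (\<forall>i. if i \<in> J then u $ i > 0 else u $ i = 0)"

definition finite_type :: "real ^ 'n ^ 'n \<Rightarrow> 'n::finite set \<Rightarrow> bool" where
  "finite_type G J \<longleftrightarrow> (\<exists>u. pos_on J u \<and> (\<forall>i\<in>J. pairing G u (fund i) > 0))"

definition affine_type :: "real ^ 'n ^ 'n \<Rightarrow> 'n::finite set \<Rightarrow> bool" where
  "affine_type G J \<longleftrightarrow> (\<exists>u. pos_on J u \<and> (\<forall>i\<in>J. pairing G u (fund i) = 0))"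

definition indefinite_type :: "real ^ 'n ^ 'n \<Rightarrow> 'n::finite set \<Rightarrow> bool" where
  "indefinite_type G J \<longleftrightarrow> (\<exists>u. pos_on J u \<and> (\<forall>i\<in>J. pairing G u (fund i) < 0))"

definition hyperbolic :: "real ^ 'n ^ 'n::finite \<Rightarrow> bool" where
  "hyperbolic G \<longleftrightarrow>
     transpose G = G \<and> (\<forall>i. G $ i $ i > 0) \<and> is_GCM (pairing G) (range fund) \<and>
     indecomposable G UNIV \<and> indefinite_type G UNIV \<and>
     (\<forall>J. J \<noteq> {} \<and> J \<noteq> UNIV \<and> indecomposable G J \<longrightarrow> finite_type G J \<or> affine_type G J)"


section \<open>The subsystem \<open>Z\<^sub>s(\<alpha>)\<^sub>r\<^sub>e\<close> and its bases\<close>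

definition C_set :: "real ^ 'n ^ 'n \<Rightarrow> real ^ 'n \<Rightarrow> real ^ 'n \<Rightarrow> (real ^ 'n::finite) set" where
  "C_set G \<alpha> \<beta> = {real m *\<^sub>R \<alpha> + real n *\<^sub>R \<beta> | m n. m > 0 \<and> n > 0} \<inter> real_roots G"

definition Z_set :: "real ^ 'n ^ 'n \<Rightarrow> real ^ 'n \<Rightarrow> (real ^ 'n::finite) set" where
  "Z_set G \<alpha> = {\<beta> \<in> roots G. C_set G \<alpha> \<beta> = {}}"

definition Zs :: "real ^ 'n ^ 'n \<Rightarrow> real ^ 'n \<Rightarrow> (real ^ 'n::finite) set" where
  "Zs G \<alpha> = Z_set G \<alpha> \<inter> uminus ` Z_set G \<alpha>"

definition Zs_re :: "real ^ 'n ^ 'n \<Rightarrow> real ^ 'n \<Rightarrow> (real ^ 'n::finite) set" where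
  "Zs_re G \<alpha> = Zs G \<alpha> \<inter> real_roots G"

definition nonneg_int_span :: "(real ^ 'n::finite) set \<Rightarrow> (real ^ 'n) set" where
  "nonneg_int_span S =
     {(\<Sum>\<gamma>\<in>F. real (c \<gamma>) *\<^sub>R \<gamma>) | F c. finite F \<and> F \<subseteq> S}"

definition weakly_independent :: "(real ^ 'n::finite) set \<Rightarrow> bool" where
  "weakly_independent \<Gamma> \<longleftrightarrow>
     (\<forall>\<gamma>\<in>\<Gamma>. range (\<lambda>k::int. of_int k *\<^sub>R \<gamma>) \<inter> nonneg_int_span (\<Gamma> - {\<gamma>}) = {0})"

definition is_basis_Zs_re ::
  "real ^ 'n ^ 'n \<Rightarrow> real ^ 'n \<Rightarrow> (real ^ 'n::finite) set \<Rightarrow> bool" where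
  "is_basis_Zs_re G \<alpha> \<Gamma> \<longleftrightarrow>
     \<Gamma> \<subseteq> Zs_re G \<alpha> \<and> (\<forall>\<gamma>\<in>\<Gamma>. \<forall>i. \<gamma> $ i \<ge> 0) \<and>
     weakly_independent \<Gamma> \<and> is_GCM (pairing G) \<Gamma> \<and>
     Zs_re G \<alpha> = {w \<gamma> | w \<gamma>. w \<in> reflection_group G \<Gamma> \<and> \<gamma> \<in> \<Gamma>}"


section \<open>Table entries in rank 3\<close>

text \<open>In the index type \<open>3\<close> the three indices are \<open>1\<close>, \<open>2\<close> and \<open>3 = 0\<close>.\<close>

fun vec3 :: "real \<times> real \<times> real \<Rightarrow> real ^ 3" where
  "vec3 (k1, k2, k3) = vector [k1, k2, k3]"

fun gram :: "real \<times> real \<times> real \<Rightarrow> real \<times> real \<times> real \<Rightarrow> real ^ 3 ^ 3" where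
  "gram (n1, n2, n3) (b12, b13, b23) =
     vector [vector [n1, - b12 / 2, - b13 / 2],
             vector [- b12 / 2, n2, - b23 / 2],
             vector [- b13 / 2, - b23 / 2, n3]]"

definition entry0 :: "real ^ 3 ^ 3 \<Rightarrow> 3 \<Rightarrow> bool" where
  "entry0 G i \<longleftrightarrow> Zs_re G (fund i) = {}"

definition entry1 :: "real ^ 3 ^ 3 \<Rightarrow> 3 \<Rightarrow> real \<times> real \<times> real \<Rightarrow> bool" where
  "entry1 G i \<beta> \<longleftrightarrow> Zs_re G (fund i) = {vec3 \<beta>, - vec3 \<beta>}"

definition entry2 ::
  "real ^ 3 ^ 3 \<Rightarrow> 3 \<Rightarrow> real \<times> real \<times> real \<Rightarrow> real \<times> real \<times> real \<Rightarrow> real \<times> real \<Rightarrow> bool" where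
  "entry2 G i \<beta>1 \<beta>2 pq \<longleftrightarrow>
     is_basis_Zs_re G (fund i) {vec3 \<beta>1, vec3 \<beta>2} \<and>
     pairing G (vec3 \<beta>1) (vec3 \<beta>2) = - fst pq \<and>
     pairing G (vec3 \<beta>2) (vec3 \<beta>1) = - snd pq"


section \<open>Imaginary roots do not matter for \<open>Z\<^sub>s(\<alpha>)\<^sub>r\<^sub>e\<close>\<close>

lemma linear_reflection: "linear (reflection G y)"
  by (rule linearI)
    (simp_all add: reflection_def pairing_def form_def inner_add_left algebra_simps
      add_divide_distrib distrib_left)

lemma linear_reflection_group: "w \<in> reflection_group G S \<Longrightarrow> linear w"
proof (induction rule: reflection_group.induct)
  case one
  show ?case by (rule linear_id)
next
  case (mult v w)
  then show ?case by (intro linear_compose)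
qed (rule linear_reflection)

lemma form_fund: "form G (fund i) (fund j) = G $ i $ j"
  by (simp add: form_def fund_def inner_axis' matrix_vector_mult_basis column_def)

lemma uminus_real_roots:
  assumes "\<And>i. G $ i $ i \<noteq> 0" and "\<beta> \<in> real_roots G"
  shows "- \<beta> \<in> real_roots G"
proof -
  obtain w i where w: "w \<in> weyl_group G" and \<beta>: "\<beta> = w (fund i)"
    using assms(2) by (auto simp: real_roots_def)
  have "linear w"
    using w linear_reflection_group by (auto simp: weyl_group_def)
  have "reflection G (fund i) (fund i) = - fund i"
    using assms(1)[of i] by (simp add: reflection_def pairing_def form_fund scaleR_2)
  then have "(w \<circ> reflection G (fund i)) (fund i) = - \<beta>"
    using \<open>linear w\<close> by (simp add: \<beta> linear_neg)
  moreover have "w \<circ> reflection G (fund i) \<in> weyl_group G"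
    using w by (auto simp: weyl_group_def intro: reflection_group.intros)
  ultimately show ?thesis
    unfolding real_roots_def by (smt (verit, best) mem_Collect_eq)
qed

lemma Zs_re_eq:
  assumes "\<And>i. G $ i $ i \<noteq> 0"
  shows "Zs_re G \<alpha> = {\<beta> \<in> real_roots G. C_set G \<alpha> \<beta> = {} \<and> C_set G \<alpha> (- \<beta>) = {}}"
proof -
  have "\<beta> \<in> uminus ` Z_set G \<alpha> \<longleftrightarrow> - \<beta> \<in> Z_set G \<alpha>" for \<beta>
    by (metis (no_types, lifting) image_iff minus_minus)
  then show ?thesis
    using uminus_real_roots[OF assms] by (auto simp: Zs_re_def Zs_def Z_set_def roots_def)
qed

end

theory Submission
  imports Defs
begin

text \<open>
  The theorem reduces to arithmetic in the root lattice, which is done on integer triples.  Write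
  \<open>N k\<close> for the norm of \<open>k\<close> and \<open>B k l\<close> for twice the form.  Three steps carry the proof.

  \<^item> Real roots are recognised by divisibility: \<open>k\<close> is a real root iff \<open>N k > 0\<close> and \<open>N k\<close>
    divides every \<open>n\<^sub>i k\<^sub>i\<close>, which says that the coroot of \<open>k\<close> lies in the coroot lattice
    (\<open>real_roots_eq\<close>).  The condition is invariant under simple reflections, which gives one
    direction.  For the other, simple reflections lower the height of a nonnegative \<open>k\<close> until a
    simple root is reached; this works because in rank 3 a vector with coordinates of both signs
    never satisfies the condition (\<open>mixed_sign_core\<close>), the proper subdiagrams being of finite or
    affine type.

  \<^item> A real root \<open>k\<close> lies in \<open>Z\<^sub>s(a)\<close> iff it is orthogonal to \<open>a\<close> and does not satisfy
    \<open>N k = N a\<close> with \<open>a + k\<close> a root (\<open>Zs_re_emb\<close>).  Indeed a root \<open>\<gamma> = m a + l k\<close> with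
    \<open>a\<close> orthogonal to \<open>k\<close> and \<open>m, l > 0\<close> has positive integral pairings \<open>P, Q\<close> of \<open>a, k\<close> with
    its coroot, and \<open>m P + l Q = 2\<close> forces all four numbers to be 1.

  \<^item> What remains are binary quadratic forms on the planes orthogonal to \<open>a\<close>, and there are three
    cases.  If the plane contains two isotropic lines, the form splits into linear factors
    and divisibility leaves finitely many candidates (\<open>null_line_check_sound\<close>).  If there are
    two proposed basis roots, reflections in them lower the coefficients of a root in the cone that
    they span, until the coefficients have different signs, which finitely many roots of
    \<open>Z\<^sub>s(a)\<close> satisfy (\<open>reflection_check_sound\<close>).  In the remaining cases \<open>Z\<^sub>s(a)\<close> is empty by congruences
    (\<open>congruence_check_sound\<close>).

  Every row is thereby reduced to a finite computation on a certificate, and the certificates are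
  collected in \<open>table\<close>.
\<close>


section \<open>Integer vectors and the form\<close>

type_synonym ivec = "int \<times> int \<times> int"

text \<open>
  The arguments \<open>n = (n1, n2, n3)\<close> and \<open>b = (b12, b13, b23)\<close> specify the root system.  Twice the
  form is used because the form itself may take half-integral values; its norm \<open>nrm\<close> is integral.
\<close>
fun bil :: "ivec \<Rightarrow> ivec \<Rightarrow> ivec \<Rightarrow> ivec \<Rightarrow> int" where
  "bil (n1, n2, n3) (b12, b13, b23) (x1, x2, x3) (y1, y2, y3) =
     2 * (n1 * x1 * y1 + n2 * x2 * y2 + n3 * x3 * y3) - b12 * (x1 * y2 + x2 * y1)
     - b13 * (x1 * y3 + x3 * y1) - b23 * (x2 * y3 + x3 * y2)"

fun nrm :: "ivec \<Rightarrow> ivec \<Rightarrow> ivec \<Rightarrow> int" where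
  "nrm (n1, n2, n3) (b12, b13, b23) (x1, x2, x3) =
     n1 * x1 * x1 + n2 * x2 * x2 + n3 * x3 * x3 - b12 * x1 * x2 - b13 * x1 * x3 - b23 * x2 * x3"

fun smul :: "int \<Rightarrow> ivec \<Rightarrow> ivec" where
  "smul c (x1, x2, x3) = (c * x1, c * x2, c * x3)"

fun all_dvd :: "int \<Rightarrow> ivec \<Rightarrow> ivec \<Rightarrow> bool" where
  "all_dvd d (n1, n2, n3) (x1, x2, x3) \<longleftrightarrow> d dvd n1 * x1 \<and> d dvd n2 * x2 \<and> d dvd n3 * x3"

text \<open>
  The coroot $2k/N(k)$ has coordinates $k_i n_i/N(k)$ with respect to the simple coroots; the
  definition asks for their integrality.
\<close>
definition iroot :: "ivec \<Rightarrow> ivec \<Rightarrow> ivec \<Rightarrow> bool" where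
  "iroot n b k \<longleftrightarrow> 0 < nrm n b k \<and> all_dvd (nrm n b k) n k"

fun det3 :: "ivec \<Rightarrow> ivec \<Rightarrow> ivec \<Rightarrow> int" where
  "det3 (a1, a2, a3) (u1, u2, u3) (v1, v2, v3) =
     a1 * (u2 * v3 - u3 * v2) - a2 * (u1 * v3 - u3 * v1) + a3 * (u1 * v2 - u2 * v1)"

fun emb :: "ivec \<Rightarrow> real ^ 3" where
  "emb (x1, x2, x3) = vector [of_int x1, of_int x2, of_int x3]"

fun int_gram :: "ivec \<Rightarrow> ivec \<Rightarrow> real ^ 3 ^ 3" where
  "int_gram (n1, n2, n3) (b12, b13, b23) =
     gram (of_int n1, of_int n2, of_int n3) (of_int b12, of_int b13, of_int b23)"

lemma bil_add: "bil n b (x + y) z = bil n b x z + bil n b y z"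
  by (cases n; cases b; cases x; cases y; cases z) (simp add: algebra_simps)

lemma bil_diff: "bil n b (x - y) z = bil n b x z - bil n b y z"
  by (cases n; cases b; cases x; cases y; cases z) (simp add: algebra_simps)

lemma bil_smul: "bil n b (smul c x) z = c * bil n b x z"
  by (cases n; cases b; cases x; cases z) (simp add: algebra_simps)

lemma bil_minus: "bil n b (- x) z = - bil n b x z"
  by (cases n; cases b; cases x; cases z) (simp add: algebra_simps)

lemma bil_commute: "bil n b x y = bil n b y x"
  by (cases n; cases b; cases x; cases y) (simp add: algebra_simps)

lemma bil_right:
  "bil n b z (x + y) = bil n b z x + bil n b z y"
  "bil n b z (x - y) = bil n b z x - bil n b z y"
  "bil n b z (smul c x) = c * bil n b z x"
  "bil n b z (- x) = - bil n b z x"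
  by (simp_all add: bil_commute[of n b z] bil_add bil_diff bil_smul bil_minus)

lemmas bil_lin = bil_add bil_diff bil_smul bil_minus bil_right

lemma bil_self: "bil n b x x = 2 * nrm n b x"
  by (cases n; cases b; cases x) (simp add: algebra_simps)

lemma nrm_add: "nrm n b (x + y) = nrm n b x + bil n b x y + nrm n b y"
  by (cases n; cases b; cases x; cases y) (simp add: algebra_simps)

lemma nrm_smul: "nrm n b (smul c x) = c\<^sup>2 * nrm n b x"
  by (cases n; cases b; cases x) (simp add: algebra_simps power2_eq_square)

lemma nrm_minus: "nrm n b (- x) = nrm n b x"
  by (cases n; cases b; cases x) simp

lemma nrm_diff: "nrm n b (x - y) = nrm n b x - bil n b x y + nrm n b y"
  using nrm_add[of n b x "- y"] by (simp add: nrm_minus bil_lin)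

lemma smul_one [simp]: "smul 1 x = x"
  by (cases x) simp

lemma smul_cancel: "c \<noteq> 0 \<Longrightarrow> smul c x = smul c y \<longleftrightarrow> x = y"
  by (cases x; cases y) simp

lemma all_dvd_add: "all_dvd d n x \<Longrightarrow> all_dvd d n y \<Longrightarrow> all_dvd d n (x + y)"
  by (cases n; cases x; cases y) (simp add: distrib_left)

lemma all_dvd_minus: "all_dvd d n (- x) \<longleftrightarrow> all_dvd d n x"
  by (cases n; cases x) simp

lemma iroot_minus: "iroot n b (- x) \<longleftrightarrow> iroot n b x"
  by (simp add: iroot_def nrm_minus all_dvd_minus)

lemma cramer:
  "smul (det3 a u v) k = smul (det3 k u v) a + smul (det3 a k v) u + smul (det3 a u k) v"
  by (cases a; cases u; cases v; cases k) (simp add: algebra_simps)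

lemma emb_lin:
  "emb (x + y) = emb x + emb y" "emb (x - y) = emb x - emb y"
  "emb (smul c x) = of_int c *\<^sub>R emb x" "emb (- x) = - emb x"
  by (cases x; cases y; simp add: vec_eq_iff forall_3)+

lemma emb_inj: "emb x = emb y \<longleftrightarrow> x = y"
  by (cases x; cases y) (simp add: vec_eq_iff forall_3)

lemma emb_nonneg: "(\<forall>i. emb (x1, x2, x3) $ i \<ge> 0) \<longleftrightarrow> x1 \<ge> 0 \<and> x2 \<ge> 0 \<and> x3 \<ge> 0"
  by (simp add: forall_3)

lemma fund_emb: "fund 1 = emb (1, 0, 0)" "fund 2 = emb (0, 1, 0)" "fund 3 = emb (0, 0, 1)"
  by (simp_all add: fund_def axis_def vec_eq_iff forall_3)

lemma form_emb: "form (int_gram n b) (emb x) (emb y) = of_int (bil n b x y) / 2"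
  by (cases n; cases b; cases x; cases y)
    (simp add: form_def inner_vec_def matrix_vector_mult_def sum_3 field_simps)

lemma pairing_emb: "pairing (int_gram n b) (emb x) (emb y) = of_int (bil n b x y) / of_int (nrm n b y)"
  by (simp add: pairing_def form_emb bil_self)

declare emb.simps [simp del] int_gram.simps [simp del]


section \<open>Real roots as integer vectors\<close>

text \<open>
  The last three lines say that proper subdiagrams are of finite or affine type, that the diagram
  is connected, and that the determinant of the Gram matrix is negative.
\<close>
fun hyperbolic_data :: "ivec \<Rightarrow> ivec \<Rightarrow> bool" where
  "hyperbolic_data (n1, n2, n3) (b12, b13, b23) \<longleftrightarrow>
     0 < n1 \<and> 0 < n2 \<and> 0 < n3 \<and> 0 \<le> b12 \<and> 0 \<le> b13 \<and> 0 \<le> b23 \<and>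
     n1 dvd b12 \<and> n2 dvd b12 \<and> n1 dvd b13 \<and> n3 dvd b13 \<and> n2 dvd b23 \<and> n3 dvd b23 \<and>
     b12 * b12 \<le> 4 * n1 * n2 \<and> b13 * b13 \<le> 4 * n1 * n3 \<and> b23 * b23 \<le> 4 * n2 * n3 \<and>
     (b12 \<noteq> 0 \<or> b13 \<noteq> 0) \<and> (b12 \<noteq> 0 \<or> b23 \<noteq> 0) \<and> (b13 \<noteq> 0 \<or> b23 \<noteq> 0) \<and>
     4 * n1 * n2 * n3 < b12 * b13 * b23 + n1 * b23 * b23 + n2 * b13 * b13 + n3 * b12 * b12"

fun coords :: "ivec \<Rightarrow> int list" where
  "coords (x1, x2, x3) = [x1, x2, x3]"

fun nonneg3 :: "ivec \<Rightarrow> bool" where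
  "nonneg3 (x1, x2, x3) \<longleftrightarrow> x1 \<ge> 0 \<and> x2 \<ge> 0 \<and> x3 \<ge> 0"

definition units :: "ivec set" where
  "units = {(1, 0, 0), (0, 1, 0), (0, 0, 1)}"

definition refl_int :: "ivec \<Rightarrow> ivec \<Rightarrow> ivec \<Rightarrow> ivec \<Rightarrow> ivec" where
  "refl_int n b r k = k - smul (bil n b k r div nrm n b r) r"

lemma range_fund: "range fund = emb ` units"
  by (auto simp: units_def fund_emb UNIV_3)

text \<open>
  Here \<open>D\<close> is the norm of \<open>x \<alpha> - y \<beta> - z \<gamma>\<close>.  Divisibility bounds it by \<open>a x\<close>, hence by the norm
  of \<open>x \<alpha>\<close>, while the other contributions are nonnegative: the norm of \<open>y \<beta> + z \<gamma>\<close> by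
  semidefiniteness, the cross terms by sign.  So all of them vanish, and as \<open>\<alpha>\<close> is joined to
  \<open>\<beta>\<close> or \<open>\<gamma>\<close>, this leaves only \<open>y = z = 0\<close>.
\<close>
lemma mixed_sign_core:
  fixes a b c p q r x y z :: int
  assumes "a > 0" "b > 0" "c > 0" "p \<ge> 0" "q \<ge> 0" "r * r \<le> 4 * b * c" "p \<noteq> 0 \<or> q \<noteq> 0"
    and "x > 0" "y \<ge> 0" "z \<ge> 0"
    and D: "D = a * x * x + b * y * y + c * z * z + p * x * y + q * x * z - r * y * z"
    and "D dvd a * x"
  shows "y = 0 \<and> z = 0"
proof -
  have "D \<le> a * x"
    using assms by (intro zdvd_imp_le) auto
  also have "a * x \<le> a * x * x"
    using assms by (simp add: mult_le_cancel_left)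
  finally have 1: "(b * y * y + c * z * z - r * y * z) + p * x * y + q * x * z \<le> 0"
    by (simp add: D)
  have "4 * b * (b * y * y + c * z * z - r * y * z) =
      (2 * b * y - r * z)\<^sup>2 + (4 * b * c - r * r) * z\<^sup>2"
    by (simp add: power2_eq_square algebra_simps)
  also have "\<dots> \<ge> 0"
    using assms by simp
  finally have 2: "b * y * y + c * z * z - r * y * z \<ge> 0"
    using \<open>b > 0\<close> by (simp add: zero_le_mult_iff)
  have 3: "p * x * y \<ge> 0" "q * x * z \<ge> 0"
    using assms by auto
  have 4: "p * x * y = 0" "q * x * z = 0" "b * y * y + c * z * z - r * y * z = 0"
    using 1 2 3 by linarith+
  then have "y = 0 \<or> z = 0"
    using assms by auto
  with 4(3) show ?thesis
    using assms by auto
qed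

text \<open>Uses that \<open>n\<^sub>i\<close> divides \<open>b\<^sub>i\<^sub>j\<close>, that is, the integrality of the Cartan matrix.\<close>
lemma all_dvd_bil:
  assumes "hyperbolic_data n b" "all_dvd d n k"
  shows "d dvd bil n b k l"
proof -
  obtain n1 n2 n3 b12 b13 b23 x1 x2 x3 y1 y2 y3
    where eq: "n = (n1, n2, n3)" "b = (b12, b13, b23)" "k = (x1, x2, x3)" "l = (y1, y2, y3)"
    by (metis prod_cases3)
  have d: "d dvd n1 * x1" "d dvd n2 * x2" "d dvd n3 * x3"
    using assms(2) by (auto simp: eq)
  have "d dvd b12 * x1" "d dvd b12 * x2" "d dvd b13 * x1" "d dvd b13 * x3"
    "d dvd b23 * x2" "d dvd b23 * x3"
    using assms(1) d by (auto simp: eq intro: dvd_trans[OF _ mult_dvd_mono[OF _ dvd_refl]])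
  note * = this[THEN dvd_mult2] d[THEN dvd_mult2]
  have "bil n b k l = 2 * (n1 * x1 * y1 + n2 * x2 * y2 + n3 * x3 * y3) - (b12 * x1 * y2 + b12 * x2 * y1)
     - (b13 * x1 * y3 + b13 * x3 * y1) - (b23 * x2 * y3 + b23 * x3 * y2)"
    by (simp add: eq algebra_simps)
  then show ?thesis
    using * by (metis dvd_add dvd_diff dvd_mult)
qed

locale hyperbolic_lattice =
  fixes n b :: ivec
  assumes hyp: "hyperbolic_data n b"
begin

abbreviation B where "B \<equiv> bil n b"
abbreviation N where "N \<equiv> nrm n b"
abbreviation root where "root \<equiv> iroot n b"
abbreviation s where "s \<equiv> refl_int n b"
abbreviation G where "G \<equiv> int_gram n b"

lemma root_pos: "root k \<Longrightarrow> N k > 0"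
  by (simp add: iroot_def)

lemma root_dvd: "root k \<Longrightarrow> N k dvd B k l" "root k \<Longrightarrow> N k dvd B l k"
  using all_dvd_bil[OF hyp] by (auto simp: iroot_def bil_commute[of n b l])

lemma s_eq:
  assumes "root r"
  obtains c where "B k r = c * N r" "s r k = k - smul c r"
proof -
  obtain c where "B k r = c * N r"
    using root_dvd(2)[OF assms, of k] by (metis dvdE mult.commute)
  then show ?thesis
    using that[of c] root_pos[OF assms] by (simp add: refl_int_def)
qed

lemma emb_s:
  assumes "root r"
  shows "emb (s r k) = reflection G (emb r) (emb k)"
proof -
  obtain c where "B k r = c * N r" "s r k = k - smul c r"
    by (rule s_eq[OF assms])
  then show ?thesis
    using root_pos[OF assms] by (simp add: reflection_def pairing_emb emb_lin)
qed

lemma s_s: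
  assumes r: "root r"
  shows "s r (s r k) = k"
proof -
  obtain c where c: "B k r = c * N r" "s r k = k - smul c r"
    by (rule s_eq[OF r])
  have "B (s r k) r = (- c) * N r"
    by (simp add: c bil_lin bil_self)
  then have "B (s r k) r div N r = - c"
    using root_pos[OF r] by (metis nonzero_mult_div_cancel_right less_irrefl)
  then have "s r (s r k) = s r k - smul (- c) r"
    by (simp add: refl_int_def[of n b r "s r k"])
  also have "\<dots> = k"
    unfolding c(2) by (cases k; cases r) simp
  finally show ?thesis .
qed

lemma N_s:
  assumes r: "root r"
  shows "N (s r k) = N k"
proof -
  obtain c where c: "B k r = c * N r" "s r k = k - smul c r"
    by (rule s_eq[OF r])
  show ?thesis
    unfolding c(2) nrm_diff nrm_smul bil_lin c(1) by (simp add: power2_eq_square)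
qed

text \<open>
  The multiple \<open>c\<close> of \<open>r\<close> that is subtracted from \<open>k\<close> satisfies \<open>c n\<^sub>i r\<^sub>i = B k r (n\<^sub>i r\<^sub>i / N r)\<close>,
  and \<open>N k\<close> divides \<open>B k r\<close>.
\<close>
lemma root_s:
  assumes r: "root r" and k: "root k"
  shows "root (s r k)"
proof -
  obtain c where c: "B k r = c * N r" "s r k = k - smul c r"
    by (rule s_eq[OF r])
  have "all_dvd (N k) n (smul c r)"
  proof -
    obtain n1 n2 n3 r1 r2 r3 where eq: "n = (n1, n2, n3)" "r = (r1, r2, r3)"
      by (metis prod_cases3)
    obtain t1 t2 t3 where t: "n1 * r1 = N r * t1" "n2 * r2 = N r * t2" "n3 * r3 = N r * t3"
      using r unfolding iroot_def eq(1) unfolding eq(2) by (auto elim!: dvdE)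
    have "n1 * (c * r1) = B k r * t1" "n2 * (c * r2) = B k r * t2" "n3 * (c * r3) = B k r * t3"
      using t by (metis c(1) mult.assoc mult.left_commute)+
    then show ?thesis
      using root_dvd(1)[OF k, of r] unfolding eq by auto
  qed
  then have "all_dvd (N k) n (s r k)"
    using k all_dvd_add[of "N k" n k "- smul c r"] by (simp add: c iroot_def all_dvd_minus)
  then show ?thesis
    using k by (simp add: iroot_def N_s[OF r])
qed

lemma root_s_iff: "root r \<Longrightarrow> root (s r k) \<longleftrightarrow> root k"
  using root_s s_s by metis

lemma root_unit: "u \<in> units \<Longrightarrow> root u"
  using hyp by (cases n; cases b) (auto simp: units_def iroot_def)

lemma root_nonneg_or_nonpos:
  assumes "root k"
  shows "nonneg3 k \<or> nonneg3 (- k)"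
proof -
  obtain n1 n2 n3 b12 b13 b23 k1 k2 k3
    where eq: "n = (n1, n2, n3)" "b = (b12, b13, b23)" "k = (k1, k2, k3)"
    by (metis prod_cases3)
  have *: "(0 < x1 \<and> x2 \<le> 0 \<and> x3 \<le> 0 \<longrightarrow> x2 = 0 \<and> x3 = 0) \<and>
    (0 < x2 \<and> x1 \<le> 0 \<and> x3 \<le> 0 \<longrightarrow> x1 = 0 \<and> x3 = 0) \<and>
    (0 < x3 \<and> x1 \<le> 0 \<and> x2 \<le> 0 \<longrightarrow> x1 = 0 \<and> x2 = 0)"
    if x: "root (x1, x2, x3)" for x1 x2 x3
  proof -
    have h: "n1 > 0" "n2 > 0" "n3 > 0" "b12 \<ge> 0" "b13 \<ge> 0" "b23 \<ge> 0"
      "b12 * b12 \<le> 4 * n1 * n2" "b13 * b13 \<le> 4 * n1 * n3" "b23 * b23 \<le> 4 * n2 * n3"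
      "b12 \<noteq> 0 \<or> b13 \<noteq> 0" "b12 \<noteq> 0 \<or> b23 \<noteq> 0" "b13 \<noteq> 0 \<or> b23 \<noteq> 0"
      using hyp by (simp_all add: eq)
    have d: "N (x1, x2, x3) dvd n1 * x1" "N (x1, x2, x3) dvd n2 * x2" "N (x1, x2, x3) dvd n3 * x3"
      using x by (simp_all add: eq iroot_def)
    note e = nrm.simps[of n1 n2 n3 b12 b13 b23 x1 x2 x3, folded eq]
    show ?thesis
      using mixed_sign_core[OF h(1-5) h(9) h(10), of x1 "- x2" "- x3" "N (x1, x2, x3)"]
        mixed_sign_core[OF h(2) h(1) h(3) h(4) h(6) h(8) h(11), of x2 "- x1" "- x3" "N (x1, x2, x3)"]
        mixed_sign_core[OF h(3) h(1) h(2) h(5) h(6) h(7) h(12), of x3 "- x1" "- x2" "N (x1, x2, x3)"]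
        d
      by (auto simp: e mult.commute mult.left_commute)
  qed
  have "root (- k1, - k2, - k3)"
    using assms iroot_minus[of n b k] by (simp add: eq)
  from *[OF this] *[of k1 k2 k3] assms show ?thesis
    unfolding eq by simp (smt (verit))
qed

text \<open>Transfers invariants from the reflections on triples to the reflection group on vectors.\<close>
lemma reflection_group_emb:
  assumes "w \<in> reflection_group G (emb ` S)" and "\<And>r. r \<in> S \<Longrightarrow> root r"
    and "\<And>r k. r \<in> S \<Longrightarrow> P k \<Longrightarrow> P (s r k)" and "P k"
  shows "\<exists>k'. w (emb k) = emb k' \<and> P k'"
  using assms(1,4)
proof (induction arbitrary: k)
  case one
  then show ?case
    by (metis id_apply)
next
  case (gen \<gamma>)
  then obtain r where "r \<in> S" "\<gamma> = emb r"
    by blast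
  then show ?case
    using assms(2,3) gen emb_s by metis
next
  case (mult v w)
  then show ?case
    by (metis comp_apply)
qed

lemma real_roots_imp:
  assumes "x \<in> real_roots G"
  obtains k where "x = emb k" "root k" "N k \<in> set (coords n)"
proof -
  obtain w i where w: "w \<in> reflection_group G (emb ` units)" "x = w (fund i)"
    using assms by (auto simp: real_roots_def weyl_group_def range_fund)
  obtain u where u: "u \<in> units" "fund i = emb u"
    using range_fund by (metis imageE rangeI)
  have "N u \<in> set (coords n)"
    using u by (cases n; cases b) (auto simp: units_def)
  then show ?thesis
    using reflection_group_emb[OF w(1), of "\<lambda>k. root k \<and> N k = N u" u] root_unit u w(2) root_s N_s that
    by auto
qed

lemma real_roots_step:
  assumes "u \<in> units" "emb (s u k) \<in> real_roots G"
  shows "emb k \<in> real_roots G"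
proof -
  obtain w i where w: "w \<in> weyl_group G" "emb (s u k) = w (fund i)"
    using assms(2) by (auto simp: real_roots_def)
  have "emb u \<in> range fund"
    using assms(1) by (simp add: range_fund)
  then have "reflection G (emb u) \<circ> w \<in> weyl_group G"
    using w(1) unfolding weyl_group_def by (intro reflection_group.mult reflection_group.gen)
  moreover have "emb k = (reflection G (emb u) \<circ> w) (fund i)"
    using emb_s[OF root_unit[OF assms(1)], of "s u k"] s_s[OF root_unit[OF assms(1)]] w(2) by simp
  ultimately show ?thesis
    unfolding real_roots_def by blast
qed

lemma unit_real:
  assumes "u \<in> units"
  shows "emb u \<in> real_roots G"
proof -
  obtain i where "emb u = id (fund i)"
    using assms range_fund by (metis id_apply image_iff)
  then show ?thesis
    unfolding real_roots_def weyl_group_def by (blast intro: reflection_group.one)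
qed

lemma gram_diag_nonzero: "G $ i $ i \<noteq> 0"
  using hyp exhaust_3[of i] by (cases n; cases b) (auto simp: int_gram.simps)

text \<open>
  Descent on the height.  Since \<open>2 N k\<close> is the combination of the \<open>B k u\<close> over the simple roots \<open>u\<close>
  with coefficients \<open>k\<^sub>i \<ge> 0\<close>, some \<open>B k u\<close> is positive and \<open>s u\<close> lowers the height.  If the result
  is not nonnegative, it is nonpositive, so that \<open>k\<close> is a multiple of \<open>u\<close>, hence \<open>u\<close> itself.
\<close>
lemma nonneg_root_imp_real:
  assumes "root k" "nonneg3 k"
  shows "emb k \<in> real_roots G"
  using assms
proof (induction "nat (sum_list (coords k))" arbitrary: k rule: less_induct)
  case less
  obtain k1 k2 k3 where k: "k = (k1, k2, k3)"
    by (metis prod_cases3)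
  have "2 * N k = k1 * B k (1, 0, 0) + k2 * B k (0, 1, 0) + k3 * B k (0, 0, 1)"
    by (cases n; cases b) (simp add: k algebra_simps)
  moreover have "N k > 0"
    using less root_pos by blast
  moreover have "k1 * B k (1, 0, 0) \<le> 0" if "B k (1, 0, 0) \<le> 0"
    using that less(3) k by (simp add: mult_nonneg_nonpos)
  moreover have "k2 * B k (0, 1, 0) \<le> 0" if "B k (0, 1, 0) \<le> 0"
    using that less(3) k by (simp add: mult_nonneg_nonpos)
  moreover have "k3 * B k (0, 0, 1) \<le> 0" if "B k (0, 0, 1) \<le> 0"
    using that less(3) k by (simp add: mult_nonneg_nonpos)
  ultimately have "B k (1, 0, 0) > 0 \<or> B k (0, 1, 0) > 0 \<or> B k (0, 0, 1) > 0"
    by linarith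
  then obtain u where u: "u \<in> units" "B k u > 0"
    by (auto simp: units_def)
  have ru: "root u"
    using u root_unit by blast
  obtain c where c: "B k u = c * N u" "s u k = k - smul c u"
    by (rule s_eq[OF ru])
  have "c > 0"
    using u root_pos[OF ru] c by (simp add: zero_less_mult_iff)
  show ?case
  proof (cases "nonneg3 (s u k)")
    case True
    have "nat (sum_list (coords (s u k))) < nat (sum_list (coords k))"
      using u(1) \<open>c > 0\<close> less(3) True unfolding c(2) unfolding k by (auto simp: units_def)
    then show ?thesis
      using less(1)[of "s u k"] True root_s[OF ru less(2)] real_roots_step[OF u(1)] by blast
  next
    case False
    then have "nonneg3 (- s u k)"
      using root_nonneg_or_nonpos root_s[OF ru less(2)] by blast
    then have "\<exists>m. k = smul m u \<and> m \<ge> 0"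
      using u(1) less(3) unfolding c(2) unfolding k by (auto simp: units_def)
    then obtain m where m: "k = smul m u" "m \<ge> 0"
      by blast
    have "m > 0"
      using m \<open>N k > 0\<close> by (auto simp: nrm_smul intro: order.not_eq_order_implies_strict)
    moreover have "m\<^sup>2 dvd m"
      using u(1) less(2) hyp
      by (cases n; cases b) (auto simp: m units_def iroot_def nrm_smul algebra_simps)
    then have "m dvd 1"
      using \<open>m > 0\<close> by (simp add: power2_eq_square)
    ultimately have "k = u"
      using m by (cases u) auto
    then show ?thesis
      using u(1) unit_real by simp
  qed
qed

lemma real_roots_eq: "real_roots G = emb ` {k. root k}"
proof -
  have "emb k \<in> real_roots G" if "root k" for k
    using root_nonneg_or_nonpos[OF that] nonneg_root_imp_real[of k] nonneg_root_imp_real[of "- k"] that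
      uminus_real_roots[OF gram_diag_nonzero, of "emb (- k)"]
    by (auto simp: iroot_minus emb_lin)
  then show ?thesis
    using real_roots_imp by blast
qed

lemma emb_real_iff: "emb k \<in> real_roots G \<longleftrightarrow> root k"
  by (auto simp: real_roots_eq emb_inj)

text \<open>The Weyl group preserves the norm, so the norm of a real root is that of a simple root.\<close>
lemma root_norm: "root k \<Longrightarrow> N k \<in> set (coords n)"
  using emb_real_iff real_roots_imp emb_inj by metis

end


section \<open>Strongly orthogonal roots\<close>

definition strongly_orthogonal :: "ivec \<Rightarrow> ivec \<Rightarrow> ivec \<Rightarrow> ivec \<Rightarrow> bool" where
  "strongly_orthogonal n b a k \<longleftrightarrow> iroot n b k \<and> bil n b k a = 0 \<and>
     \<not> (nrm n b k = nrm n b a \<and> iroot n b (a + k))"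

context hyperbolic_lattice
begin

abbreviation inZ where "inZ \<equiv> strongly_orthogonal n b"

text \<open>
  If \<open>g = m a + l k\<close> is a root, the integers \<open>P = B g a / N g\<close> and \<open>Q = B g k / N g\<close> are positive,
  and \<open>m P + l Q = B g g / N g = 2\<close> forces \<open>m = l = P = Q = 1\<close>.  Then \<open>N g = 2 N a = 2 N k\<close>: the
  roots \<open>a\<close> and \<open>k\<close> are orthogonal short roots of a subsystem of type \<open>B\<^sub>2\<close>.
\<close>
lemma C_set_empty_iff:
  assumes a: "root a" and k: "root k" and "B k a = 0"
  shows "C_set G (emb a) (emb k) = {} \<longleftrightarrow> \<not> (N k = N a \<and> root (a + k))"
proof
  assume *: "C_set G (emb a) (emb k) = {}"
  show "\<not> (N k = N a \<and> root (a + k))"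
  proof
    assume "N k = N a \<and> root (a + k)"
    then have "emb a + emb k \<in> real_roots G"
      using emb_real_iff[of "a + k"] by (simp add: emb_lin)
    then have "emb a + emb k \<in> C_set G (emb a) (emb k)"
      unfolding C_set_def by (auto intro!: exI[of _ "1::nat"])
    with * show False
      by simp
  qed
next
  assume *: "\<not> (N k = N a \<and> root (a + k))"
  have "False" if x: "x \<in> C_set G (emb a) (emb k)" for x
  proof -
    obtain m l where ml: "x = real m *\<^sub>R emb a + real l *\<^sub>R emb k" "m > 0" "l > 0"
      and "x \<in> real_roots G"
      using x by (auto simp: C_set_def)
    define g where "g = smul (int m) a + smul (int l) k"
    have "x = emb g"
      by (simp add: g_def emb_lin ml)
    then have "root g"
      using \<open>x \<in> real_roots G\<close> emb_real_iff by simp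
    obtain P Q where P: "B g a = N g * P" and Q: "B g k = N g * Q"
      using root_dvd(1)[OF \<open>root g\<close>] by (meson dvdE)
    have ga: "B g a = 2 * int m * N a" "B g k = 2 * int l * N k"
      using assms(3) by (simp_all add: g_def bil_lin bil_self bil_commute[of n b a k])
    have pos: "N g > 0" "N a > 0" "N k > 0"
      using root_pos \<open>root g\<close> a k by auto
    have "N g * P > 0" "N g * Q > 0"
      unfolding P[symmetric] Q[symmetric] ga using pos ml by auto
    then have "P > 0" "Q > 0"
      using pos by (auto simp: zero_less_mult_iff)
    have "2 * N g = B g g"
      by (simp add: bil_self)
    also have "\<dots> = int m * B g a + int l * B g k"
      by (subst (2) g_def) (simp add: bil_lin)
    also have "\<dots> = N g * (int m * P + int l * Q)"
      by (simp add: P Q algebra_simps)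
    finally have "int m * P + int l * Q = 2"
      using pos by auto
    moreover have "int m * P \<ge> int m" "int m * P \<ge> P" "int l * Q \<ge> int l" "int l * Q \<ge> Q"
      using \<open>P > 0\<close> \<open>Q > 0\<close> ml by (simp_all add: mult_le_cancel_left1 mult_le_cancel_right1)
    ultimately have "int m = 1" "int l = 1" "P = 1" "Q = 1"
      using \<open>P > 0\<close> \<open>Q > 0\<close> ml by linarith+
    then have "N a = N k" "g = a + k"
      using ga P Q by (auto simp: g_def)
    then show False
      using * \<open>root g\<close> by simp
  qed
  then show "C_set G (emb a) (emb k) = {}"
    by blast
qed

text \<open>The reflection in \<open>a\<close> maps \<open>a + k\<close> to \<open>- (a - k)\<close>.\<close>
lemma root_add_diff:
  assumes "root a" "B k a = 0"
  shows "root (a - k) \<longleftrightarrow> root (a + k)"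
proof -
  have "B (a + k) a div N a = 2"
    using assms root_pos[of a] by (simp add: bil_lin bil_self)
  then have "s a (a + k) = - (a - k)"
    by (cases a; cases k) (simp add: refl_int_def)
  then show ?thesis
    using root_s_iff[OF assms(1), of "a + k"] iroot_minus[of n b "a - k"] by simp
qed

text \<open>The reflection of \<open>k\<close> in \<open>a\<close> is an element of the set.\<close>
lemma C_set_nonempty:
  assumes a: "root a" and k: "root k" and "B k a < 0"
  shows "C_set G (emb a) (emb k) \<noteq> {}"
proof -
  obtain c where c: "B k a = c * N a" "s a k = k - smul c a"
    by (rule s_eq[OF a])
  have "c < 0"
    using assms root_pos[OF a] c by (simp add: mult_less_0_iff)
  have "emb (s a k) = real (nat (- c)) *\<^sub>R emb a + real 1 *\<^sub>R emb k"
    using \<open>c < 0\<close> by (simp add: c emb_lin)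
  moreover have "emb (s a k) \<in> real_roots G"
    using root_s[OF a k] emb_real_iff by simp
  ultimately show ?thesis
    using \<open>c < 0\<close> unfolding C_set_def by (smt (verit) IntI empty_iff mem_Collect_eq zero_less_nat_eq zero_less_one)
qed

text \<open>
  A root \<open>k\<close> not orthogonal to \<open>a\<close> is excluded because \<open>k\<close> or \<open>- k\<close> pairs negatively with \<open>a\<close>; for
  orthogonal roots the conditions on \<open>k\<close> and on \<open>- k\<close> agree.
\<close>
lemma Zs_re_emb:
  assumes a: "root a"
  shows "Zs_re G (emb a) = emb ` {k. inZ a k}"
proof -
  have "(C_set G (emb a) (emb k) = {} \<and> C_set G (emb a) (- emb k) = {}) \<longleftrightarrow> inZ a k" if k: "root k" for k
  proof (cases "B k a = 0")
    case True
    then show ?thesis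
      using C_set_empty_iff[OF a k] C_set_empty_iff[OF a, of "- k"] k root_add_diff[OF a True]
      by (auto simp: strongly_orthogonal_def emb_lin iroot_minus bil_lin nrm_minus)
  next
    case False
    then have "B k a < 0 \<or> B (- k) a < 0"
      by (auto simp: bil_lin)
    then show ?thesis
      using C_set_nonempty[OF a k] C_set_nonempty[OF a, of "- k"] k False
      by (auto simp: strongly_orthogonal_def iroot_minus emb_lin)
  qed
  then show ?thesis
    unfolding Zs_re_eq[OF gram_diag_nonzero] real_roots_eq using strongly_orthogonal_def by blast
qed

lemma strongly_orthogonal_minus: "root a \<Longrightarrow> inZ a (- k) \<longleftrightarrow> inZ a k"
  using root_add_diff[of a k] by (auto simp: strongly_orthogonal_def iroot_minus bil_lin nrm_minus)

lemma strongly_orthogonal_s: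
  assumes "inZ a r" "inZ a k"
  shows "inZ a (s r k)"
proof -
  have r: "root r" "B r a = 0" and k: "root k" "B k a = 0"
    using assms by (auto simp: strongly_orthogonal_def)
  obtain c where c: "B k r = c * N r" "s r k = k - smul c r"
    by (rule s_eq[OF r(1)])
  have "B (s r k) a = 0"
    by (simp add: c r k bil_lin)
  moreover have "a + s r k = s r (a + k)"
    using r by (simp add: refl_int_def bil_lin bil_commute[of n b a])
  ultimately show ?thesis
    using assms(2) root_s_iff[OF r(1)] by (simp add: strongly_orthogonal_def N_s[OF r(1)])
qed

end


section \<open>Hyperbolic type\<close>

lemma pairing_units:
  "pairing (int_gram n b) (emb u) (fund 1) = of_int (bil n b u (1, 0, 0)) / of_int (nrm n b (1, 0, 0))"
  "pairing (int_gram n b) (emb u) (fund 2) = of_int (bil n b u (0, 1, 0)) / of_int (nrm n b (0, 1, 0))"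
  "pairing (int_gram n b) (emb u) (fund 3) = of_int (bil n b u (0, 0, 1)) / of_int (nrm n b (0, 0, 1))"
  by (simp_all add: fund_emb pairing_emb)

lemma pos_on_emb:
  "pos_on J (emb (x1, x2, x3)) \<longleftrightarrow>
     (if 1 \<in> J then x1 > 0 else x1 = 0) \<and> (if 2 \<in> J then x2 > 0 else x2 = 0) \<and>
     (if 3 \<in> J then x3 > 0 else x3 = 0)"
  by (simp add: pos_on_def forall_3 emb.simps)

text \<open>
  Explicit witnesses exist in all cases.  With $M$ twice the Gram matrix, indefiniteness is witnessed by
  $\mathrm{adj}(M)(1,1,1)^T$, which $M$ maps to $\det(M)(1,1,1)^T$; it is positive because the
  entries of the adjugate are nonnegative and no row of it vanishes.  For a pair $\{i,j\}$,
  the vector $(2n_j+b_{ij},\,2n_i+b_{ij})$ is mapped by $M$ to $4n_in_j-b_{ij}^2$ times $(1,1)$.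
\<close>
lemma hyperbolic_int_gram:
  assumes "hyperbolic_data n b"
  shows "hyperbolic (int_gram n b)"
proof -
  obtain n1 n2 n3 b12 b13 b23 where eq: "n = (n1, n2, n3)" "b = (b12, b13, b23)"
    by (metis prod_cases3)
  have h: "n1 > 0" "n2 > 0" "n3 > 0" "b12 \<ge> 0" "b13 \<ge> 0" "b23 \<ge> 0"
    "n1 dvd b12" "n2 dvd b12" "n1 dvd b13" "n3 dvd b13" "n2 dvd b23" "n3 dvd b23"
    "b12 * b12 \<le> 4 * n1 * n2" "b13 * b13 \<le> 4 * n1 * n3" "b23 * b23 \<le> 4 * n2 * n3"
    "b12 \<noteq> 0 \<or> b13 \<noteq> 0" "b12 \<noteq> 0 \<or> b23 \<noteq> 0" "b13 \<noteq> 0 \<or> b23 \<noteq> 0"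
    and det: "4 * n1 * n2 * n3 - b12 * b13 * b23 - n1 * b23 * b23 - n2 * b13 * b13 - n3 * b12 * b12 < 0"
    using assms by (simp_all add: eq)
  let ?G = "int_gram n b"
  have nv: "nrm n b (1, 0, 0) = n1" "nrm n b (0, 1, 0) = n2" "nrm n b (0, 0, 1) = n3"
    by (simp_all add: eq)
  have bv: "bil n b (x1, x2, x3) (1, 0, 0) = 2 * n1 * x1 - b12 * x2 - b13 * x3"
    "bil n b (x1, x2, x3) (0, 1, 0) = 2 * n2 * x2 - b12 * x1 - b23 * x3"
    "bil n b (x1, x2, x3) (0, 0, 1) = 2 * n3 * x3 - b13 * x1 - b23 * x2" for x1 x2 x3
    by (simp_all add: eq)
  have gv: "?G $ 1 $ 1 = of_int n1" "?G $ 2 $ 2 = of_int n2" "?G $ 3 $ 3 = of_int n3"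
    by (simp_all add: eq int_gram.simps)
  have 1: "transpose ?G = ?G"
    by (simp add: eq int_gram.simps transpose_def vec_eq_iff forall_3)
  have 2: "\<forall>i. ?G $ i $ i > 0"
    using h by (simp add: gv forall_3)
  have "pairing ?G (emb x) (emb x) = 2" if "x \<in> units" for x
    using that h by (auto simp: units_def pairing_emb nv bv)
  moreover have "pairing ?G (emb x) (emb y) \<in> \<int> \<and> pairing ?G (emb x) (emb y) \<le> 0 \<and>
      (pairing ?G (emb x) (emb y) = 0 \<longleftrightarrow> pairing ?G (emb y) (emb x) = 0)"
    if x: "x \<in> units" and y: "y \<in> units" and "x \<noteq> y" for x y
  proof -
    have pos: "nrm n b x > 0" "nrm n b y > 0"
      using x y h(1-3) nv by (auto simp: units_def)
    have "nrm n b y dvd bil n b y x"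
      using hyperbolic_lattice.root_dvd(1)[of n b y x] hyperbolic_lattice.root_unit[of n b y]
      by (simp add: hyperbolic_lattice_def assms y)
    then have "pairing ?G (emb x) (emb y) \<in> \<int>"
      by (auto simp: pairing_emb bil_commute[of n b x] elim!: dvdE)
    moreover have "bil n b x y \<le> 0"
      using that h(4-6) unfolding units_def by (elim insertE emptyE; simp add: bv)
    then have "pairing ?G (emb x) (emb y) \<le> 0"
      using pos by (simp add: pairing_emb divide_nonpos_pos)
    moreover have "pairing ?G (emb x) (emb y) = 0 \<longleftrightarrow> pairing ?G (emb y) (emb x) = 0"
      using pos by (simp add: pairing_emb bil_commute[of n b x])
    ultimately show ?thesis
      by blast
  qed
  ultimately have 3: "is_GCM (pairing ?G) (range fund)"
    unfolding is_GCM_def range_fund by blast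
  have 4: "indecomposable ?G UNIV"
    unfolding indecomposable_def
  proof (intro allI impI)
    fix J1 J2 :: "3 set"
    assume J: "J1 \<noteq> {} \<and> J2 \<noteq> {} \<and> J1 \<inter> J2 = {} \<and> J1 \<union> J2 = UNIV"
    show "\<exists>i\<in>J1. \<exists>j\<in>J2. ?G $ i $ j \<noteq> 0"
    proof (rule ccontr)
      assume "\<not> ?thesis"
      then have same: "i \<in> J1 \<longleftrightarrow> j \<in> J1" if "?G $ i $ j \<noteq> 0" "?G $ j $ i \<noteq> 0" for i j
        using J that by blast
      have "b12 \<noteq> 0 \<Longrightarrow> 1 \<in> J1 \<longleftrightarrow> 2 \<in> J1" "b13 \<noteq> 0 \<Longrightarrow> 1 \<in> J1 \<longleftrightarrow> 3 \<in> J1"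
        "b23 \<noteq> 0 \<Longrightarrow> 2 \<in> J1 \<longleftrightarrow> 3 \<in> J1"
        by (rule same; simp add: eq int_gram.simps)+
      then have "i \<in> J1 \<longleftrightarrow> 1 \<in> J1" for i
        using h(16-18) exhaust_3[of i] by blast
      then show False
        using J by blast
    qed
  qed
  have 5: "indefinite_type ?G UNIV"
  proof -
    define u where "u =
      ((4 * n2 * n3 - b23 * b23) + (2 * n3 * b12 + b13 * b23) + (2 * n2 * b13 + b12 * b23),
       (2 * n3 * b12 + b13 * b23) + (4 * n1 * n3 - b13 * b13) + (2 * n1 * b23 + b12 * b13),
       (2 * n2 * b13 + b12 * b23) + (2 * n1 * b23 + b12 * b13) + (4 * n1 * n2 - b12 * b12))"
    have pos: "n * p > 0" if "n > 0" "p \<ge> 0" "p \<noteq> 0" for n p :: int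
      using that by simp
    have nn: "0 \<le> n1 * b23" "0 \<le> n2 * b13" "0 \<le> n3 * b12" "0 \<le> b12 * b13" "0 \<le> b12 * b23" "0 \<le> b13 * b23"
      using h by simp_all
    have "0 < n3 * b12 \<or> 0 < n2 * b13" "0 < n3 * b12 \<or> 0 < n1 * b23" "0 < n2 * b13 \<or> 0 < n1 * b23"
      using pos h by blast+
    then have "pos_on UNIV (emb u)"
      using nn h(13-15)
      by (simp add: pos_on_def forall_3 u_def emb.simps del: of_int_add of_int_diff of_int_mult) linarith
    moreover have "bil n b u e = 2 * (4 * n1 * n2 * n3 - b12 * b13 * b23 - n1 * b23 * b23 - n2 * b13 * b13 - n3 * b12 * b12)"
      if "e \<in> units" for e
      using that by (auto simp: units_def eq u_def algebra_simps)
    then have "bil n b u e < 0" if "e \<in> units" for e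
      using that det by simp
    then have "\<forall>i. pairing ?G (emb u) (fund i) < 0"
      using h(1-3) by (simp add: forall_3 pairing_units nv divide_neg_pos units_def)
    ultimately show ?thesis
      unfolding indefinite_type_def by blast
  qed
  \<comment> \<open>A vector that \<open>M\<close> maps to a constant vector \<open>t\<close> on \<open>J\<close> decides between the two types
      by whether \<open>t\<close> is zero.\<close>
  have fa: "finite_type ?G J \<or> affine_type ?G J"
    if "pos_on J (emb u)" "\<forall>i\<in>J. pairing ?G (emb u) (fund i) = of_int t / ?G $ i $ i" "t \<ge> 0" for J u t
    using that 2 unfolding finite_type_def affine_type_def
    by (cases "t = 0") (metis divide_eq_0_iff of_int_0, metis divide_pos_pos of_int_pos order_le_neq_trans)
  have "finite_type ?G {1} \<or> affine_type ?G {1}"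
    by (rule fa[of _ "(1, 0, 0)" "2 * n1"])
      (use h in \<open>simp_all add: pos_on_emb pairing_units nv bv gv algebra_simps\<close>)
  moreover have "finite_type ?G {2} \<or> affine_type ?G {2}"
    by (rule fa[of _ "(0, 1, 0)" "2 * n2"])
      (use h in \<open>simp_all add: pos_on_emb pairing_units nv bv gv algebra_simps\<close>)
  moreover have "finite_type ?G {3} \<or> affine_type ?G {3}"
    by (rule fa[of _ "(0, 0, 1)" "2 * n3"])
      (use h in \<open>simp_all add: pos_on_emb pairing_units nv bv gv algebra_simps\<close>)
  moreover have "finite_type ?G {1, 2} \<or> affine_type ?G {1, 2}"
    by (rule fa[of _ "(2 * n2 + b12, 2 * n1 + b12, 0)" "4 * n1 * n2 - b12 * b12"])
      (use h in \<open>simp_all add: pos_on_emb pairing_units nv bv gv algebra_simps\<close>)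
  moreover have "finite_type ?G {1, 3} \<or> affine_type ?G {1, 3}"
    by (rule fa[of _ "(2 * n3 + b13, 0, 2 * n1 + b13)" "4 * n1 * n3 - b13 * b13"])
      (use h in \<open>simp_all add: pos_on_emb pairing_units nv bv gv algebra_simps\<close>)
  moreover have "finite_type ?G {2, 3} \<or> affine_type ?G {2, 3}"
    by (rule fa[of _ "(0, 2 * n3 + b23, 2 * n2 + b23)" "4 * n2 * n3 - b23 * b23"])
      (use h in \<open>simp_all add: pos_on_emb pairing_units nv bv gv algebra_simps\<close>)
  moreover have "J \<in> {{1}, {2}, {3}, {1, 2}, {1, 3}, {2, 3}}" if "J \<noteq> {}" "J \<noteq> UNIV" for J :: "3 set"
  proof -
    define p q r where "p \<longleftrightarrow> 1 \<in> J" and "q \<longleftrightarrow> 2 \<in> J" and "r \<longleftrightarrow> 3 \<in> J"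
    have "J = (if p then {1} else {}) \<union> (if q then {2} else {}) \<union> (if r then {3} else {})"
      (is "J = ?R")
    proof (rule set_eqI)
      show "i \<in> J \<longleftrightarrow> i \<in> ?R" for i
        using exhaust_3[of i] by (auto simp: p_def q_def r_def)
    qed
    then show ?thesis
      using that unfolding UNIV_3 by (cases p; cases q; cases r) (simp_all add: insert_commute)
  qed
  ultimately have 6: "finite_type ?G J \<or> affine_type ?G J" if "J \<noteq> {}" "J \<noteq> UNIV" for J
    using that by blast
  show ?thesis
    unfolding hyperbolic_def using 1 2 3 4 5 6 by blast
qed


section \<open>Finite enumeration of strongly orthogonal roots\<close>

fun sdiv :: "ivec \<Rightarrow> int \<Rightarrow> ivec" where
  "sdiv (x1, x2, x3) d = (x1 div d, x2 div d, x3 div d)"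

lemma smul_minus: "smul c (- x) = - smul c x"
  by (cases x) simp

lemma all_dvd_smul_left:
  assumes "d dvd c"
  shows "all_dvd d n (smul c x)"
proof -
  obtain n1 n2 n3 x1 x2 x3 where "n = (n1, n2, n3)" "x = (x1, x2, x3)"
    by (metis prod_cases3)
  then show ?thesis
    using assms by (simp add: dvd_mult dvd_mult2)
qed

lemma smul_smul: "smul c (smul d x) = smul (c * d) x"
  by (cases x) simp

lemma sdiv_eq: "d \<noteq> 0 \<Longrightarrow> smul d k = v \<Longrightarrow> sdiv v d = k"
  by (cases k) auto

lemma weakly_independent_pair:
  fixes x y :: "real ^ 3"
  assumes "x \<noteq> y"
    and "\<And>(k::int) c::nat. of_int k *\<^sub>R x = real c *\<^sub>R y \<Longrightarrow> of_int k *\<^sub>R x = 0"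
    and "\<And>(k::int) c::nat. of_int k *\<^sub>R y = real c *\<^sub>R x \<Longrightarrow> of_int k *\<^sub>R y = 0"
  shows "weakly_independent {x, y}"
proof -
  have span: "nonneg_int_span {z} = range (\<lambda>c. real c *\<^sub>R z)" for z :: "real ^ 3"
  proof (intro set_eqI iffI)
    fix v assume "v \<in> nonneg_int_span {z}"
    then obtain F c where F: "F \<subseteq> {z}" "v = (\<Sum>\<gamma>\<in>F. real (c \<gamma>) *\<^sub>R \<gamma>)"
      by (auto simp: nonneg_int_span_def)
    then have "F = {} \<or> F = {z}"
      by blast
    then show "v \<in> range (\<lambda>c. real c *\<^sub>R z)"
      using F(2) by (auto intro: range_eqI[of _ _ 0])
  next
    fix v assume "v \<in> range (\<lambda>c. real c *\<^sub>R z)"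
    then obtain c :: nat where "v = real c *\<^sub>R z"
      by auto
    then show "v \<in> nonneg_int_span {z}"
      by (auto simp: nonneg_int_span_def intro!: exI[of _ "{z}"] exI[of _ "\<lambda>_. c"])
  qed
  have "0 \<in> range (\<lambda>k::int. of_int k *\<^sub>R z)" "0 \<in> range (\<lambda>c. real c *\<^sub>R z)" for z :: "real ^ 3"
    by (auto intro: range_eqI[of _ _ 0])
  then show ?thesis
    using assms unfolding weakly_independent_def by (auto simp: span insert_Diff_if)
qed

text \<open>
  For a strongly orthogonal root \<open>k\<close> and isotropic \<open>e, f\<close> the numbers \<open>B e k\<close> and \<open>B f k\<close> are
  multiples \<open>N k p\<close> and \<open>N k q\<close>.  As \<open>B e f = N k p q\<close> and \<open>p q k = q e + p f\<close>, it is enough to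
  run through the norms \<open>\<nu>\<close> and the divisors \<open>p\<close>; replacing \<open>k\<close> by \<open>- k\<close> makes \<open>p\<close> positive.
\<close>
definition null_line_check :: "ivec \<Rightarrow> ivec \<Rightarrow> ivec \<Rightarrow> ivec \<Rightarrow> ivec \<Rightarrow> ivec list \<Rightarrow> bool" where
  "null_line_check n b a e f L \<longleftrightarrow>
     (let c = bil n b e f in
      nrm n b e = 0 \<and> nrm n b f = 0 \<and> bil n b e a = 0 \<and> bil n b f a = 0 \<and> c \<noteq> 0 \<and>
      det3 a e f \<noteq> 0 \<and> list_all (strongly_orthogonal n b a) L \<and>
      list_all (\<lambda>\<nu>. list_all (\<lambda>p.
        if c mod (\<nu> * p) = 0 then
          let q = c div (\<nu> * p); v = smul q e + smul p f; k = sdiv v (p * q) in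
          if smul (p * q) k = v then strongly_orthogonal n b a k \<longrightarrow> k \<in> set L \<or> - k \<in> set L else True
        else True) [1..\<bar>c\<bar>]) (coords n))"

text \<open>
  The divisibility conditions on \<open>M\<close> ensure that all conditions on a strongly orthogonal root of
  norm \<open>\<nu>\<close> depend only on its residues modulo \<open>M\<close>.
\<close>
definition congruence_check :: "ivec \<Rightarrow> ivec \<Rightarrow> ivec \<Rightarrow> int \<Rightarrow> bool" where
  "congruence_check n b a M \<longleftrightarrow>
     M > 0 \<and> 2 * nrm n b a dvd M \<and> list_all (\<lambda>\<nu>. \<nu> dvd M) (coords n) \<and>
     list_all (\<lambda>x. list_all (\<lambda>y. list_all (\<lambda>z.
       let r = (x, y, z) in
       if M dvd bil n b r a then
         list_all (\<lambda>\<nu>. M dvd nrm n b r - \<nu> \<longrightarrow> all_dvd \<nu> n r \<longrightarrow>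
           \<nu> = nrm n b a \<and> all_dvd (2 * \<nu>) n (a + r)) (coords n)
       else True) [0..M - 1]) [0..M - 1]) [0..M - 1]"

text \<open>
  By Cramer's rule \<open>D k\<close> is an integral combination of \<open>g\<close> and \<open>h\<close> for every \<open>k\<close> orthogonal to \<open>a\<close>.
  The enumeration runs over all combinations \<open>x g - y h\<close> with \<open>x, y \<ge> 0\<close> and \<open>x + y \<le> 2 D\<close>, which
  suffices for the roots with coefficients of different signs.
\<close>
definition reflection_check ::
  "ivec \<Rightarrow> ivec \<Rightarrow> ivec \<Rightarrow> ivec \<Rightarrow> ivec \<Rightarrow> int \<Rightarrow> int \<Rightarrow> bool" where
  "reflection_check n b a g h p q \<longleftrightarrow>
     (let D = \<bar>det3 a g h\<bar> in
      D > 0 \<and> p > 0 \<and> q > 0 \<and> strongly_orthogonal n b a g \<and> strongly_orthogonal n b a h \<and>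
      bil n b g h = - p * nrm n b h \<and> bil n b g h = - q * nrm n b g \<and> nonneg3 g \<and> nonneg3 h \<and>
      list_all (\<lambda>x. list_all (\<lambda>y.
        let v = smul x g - smul y h; k = sdiv v D in
        if smul D k = v then strongly_orthogonal n b a k \<longrightarrow> k \<in> {g, - g, h, - h} else True)
        [0..2 * D - x]) [0..2 * D])"

context hyperbolic_lattice
begin

text \<open>
  In Cramer's rule for \<open>a, u, v\<close> the coefficient of \<open>a\<close> vanishes, as everything else is orthogonal
  to \<open>a\<close>.
\<close>
lemma plane_coordinates:
  assumes "root a" "B u a = 0" "B v a = 0" "B k a = 0"
  shows "smul (det3 a u v) k = smul (det3 a k v) u + smul (det3 a u k) v"
proof -
  have "B (smul (det3 a u v) k) a = 2 * det3 k u v * N a"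
    unfolding cramer[of a u v k] by (simp add: bil_lin assms bil_self)
  then have "det3 k u v = 0"
    using assms root_pos[OF assms(1)] by (simp add: bil_lin)
  moreover have "smul 0 a = 0"
    by (cases a) (simp add: zero_prod_def)
  ultimately show ?thesis
    using cramer[of a u v k] by simp
qed

text \<open>
  The form \<open>N\<close> restricted to the plane is the product of the linear forms \<open>B e\<close> and \<open>B f\<close> up to the
  constant \<open>B e f\<close>; both factors are divisible by \<open>N k\<close>, which leaves finitely many values.
\<close>
lemma null_line_check_sound:
  assumes a: "root a" and check: "null_line_check n b a e f L"
  shows "Zs_re G (emb a) = emb ` (set L \<union> uminus ` set L)"
proof -
  define c where "c = B e f"
  have ef: "N e = 0" "N f = 0" "B e a = 0" "B f a = 0" "c \<noteq> 0" "det3 a e f \<noteq> 0"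
    and L: "\<And>k. k \<in> set L \<Longrightarrow> inZ a k"
    and *: "\<And>\<nu> p. \<nu> \<in> set (coords n) \<Longrightarrow> p \<in> {1..\<bar>c\<bar>} \<Longrightarrow> c mod (\<nu> * p) = 0 \<Longrightarrow>
      (let q = c div (\<nu> * p); v = smul q e + smul p f; k = sdiv v (p * q) in
          if smul (p * q) k = v then inZ a k \<longrightarrow> k \<in> set L \<or> - k \<in> set L else True)"
    using check unfolding null_line_check_def Let_def list_all_iff c_def[symmetric] set_upto
    by meson+
  have main: "k \<in> set L \<or> - k \<in> set L"
    if k: "inZ a k" and p: "B e k = N k * p" "p \<ge> 0" for k p
  proof -
    have rk: "root k" "B k a = 0"
      using k by (auto simp: strongly_orthogonal_def)
    obtain q where q: "B f k = N k * q"
      using root_dvd(2)[OF rk(1)] by (meson dvdE)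
    define D x y where "D = det3 a e f" and "x = det3 a k f" and "y = det3 a e k"
    have D: "smul D k = smul x e + smul y f"
      unfolding D_def x_def y_def by (rule plane_coordinates) (use a rk ef in auto)
    have Dp: "D * (N k * p) = y * c"
      using arg_cong[OF D, of "B e"] by (simp add: bil_lin bil_self ef p c_def)
    have Dq: "D * (N k * q) = x * c"
      using arg_cong[OF D, of "B f"] by (simp add: bil_lin bil_self ef q c_def bil_commute[of n b f e])
    have "smul (D * c) k = smul c (smul D k)"
      by (cases k) simp
    also have "\<dots> = smul (x * c) e + smul (y * c) f"
      unfolding D by (cases e; cases f) (simp add: algebra_simps)
    also have "\<dots> = smul D (smul (N k * q) e + smul (N k * p) f)"
      unfolding Dp[symmetric] Dq[symmetric] by (cases e; cases f) (simp add: algebra_simps)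
    finally have "smul D (smul c k) = smul D (smul (N k * q) e + smul (N k * p) f)"
      by (simp add: smul_smul)
    then have ck: "smul c k = smul (N k * q) e + smul (N k * p) f"
      using smul_cancel ef(6) D_def by blast
    have "c * (2 * N k) = B (smul c k) k"
      by (simp add: bil_lin bil_self)
    also have "\<dots> = 2 * (N k * q) * (N k * p)"
      unfolding ck by (simp add: bil_lin p q)
    finally have c: "c = N k * p * q"
      using root_pos[OF rk(1)] by simp
    have "smul (N k) (smul (p * q) k) = smul (N k) (smul q e + smul p f)"
      using ck unfolding c by (cases e; cases f; cases k) (simp add: algebra_simps)
    then have pqk: "smul (p * q) k = smul q e + smul p f"
      using smul_cancel[of "N k"] root_pos[OF rk(1)] by auto
    have "p > 0"
      using p ef(5) by (cases "p = 0") (auto simp: c)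
    have "\<bar>c\<bar> = N k * p * \<bar>q\<bar>"
      using root_pos[OF rk(1)] p by (simp add: c abs_mult)
    moreover have "N k * p * \<bar>q\<bar> \<ge> p * 1"
      using root_pos[OF rk(1)] p c ef(5) by (intro mult_mono) (auto simp: mult_le_cancel_right1)
    ultimately have "p \<in> {1..\<bar>c\<bar>}"
      using \<open>p > 0\<close> by simp
    moreover have "c div (N k * p) = q" "c mod (N k * p) = 0"
      using root_pos[OF rk(1)] \<open>p > 0\<close> by (simp_all add: c)
    moreover have "sdiv (smul q e + smul p f) (p * q) = k"
      using sdiv_eq[OF _ pqk] ef(5) c by auto
    ultimately show ?thesis
      using *[OF root_norm[OF rk(1)], of p] pqk k by (simp add: Let_def)
  qed
  have "k \<in> set L \<or> - k \<in> set L" if k: "inZ a k" for k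
  proof -
    have rk: "root k"
      using k by (auto simp: strongly_orthogonal_def)
    obtain p where p: "B e k = N k * p"
      using root_dvd(2)[OF rk] by (meson dvdE)
    show ?thesis
      using main[OF k p] main[of "- k" "- p"] k p strongly_orthogonal_minus[OF a]
      by (cases "p \<ge> 0") (auto simp: bil_lin nrm_minus)
  qed
  moreover have "- k \<in> uminus ` set L \<longleftrightarrow> k \<in> set L" for k
    by (simp add: inj_image_mem_iff)
  then have "k \<in> uminus ` set L \<longleftrightarrow> - k \<in> set L" for k
    by (metis minus_minus)
  ultimately have "{k. inZ a k} = set L \<union> uminus ` set L"
    using L strongly_orthogonal_minus[OF a] by blast
  then show ?thesis
    unfolding Zs_re_emb[OF a] by simp
qed

lemma congruence_check_sound:
  assumes a: "root a" and check: "congruence_check n b a M"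
  shows "Zs_re G (emb a) = {}"
proof -
  have M: "M > 0" "2 * N a dvd M" "\<And>\<nu>. \<nu> \<in> set (coords n) \<Longrightarrow> \<nu> dvd M"
    and *: "\<And>x y z \<nu>. \<lbrakk>x \<in> {0..M - 1}; y \<in> {0..M - 1}; z \<in> {0..M - 1};
      M dvd B (x, y, z) a; \<nu> \<in> set (coords n); M dvd N (x, y, z) - \<nu>; all_dvd \<nu> n (x, y, z)\<rbrakk> \<Longrightarrow>
      \<nu> = N a \<and> all_dvd (2 * \<nu>) n (a + (x, y, z))"
    using check unfolding congruence_check_def Let_def list_all_iff set_upto by meson+
  have "False" if k: "inZ a k" for k
  proof -
    have rk: "root k" "B k a = 0"
      using k by (auto simp: strongly_orthogonal_def)
    obtain x y z where xyz: "k = (x, y, z)"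
      by (metis prod_cases3)
    define r t where "r = (x mod M, y mod M, z mod M)" and "t = (x div M, y div M, z div M)"
    have kr: "k = r + smul M t"
      by (simp add: xyz r_def t_def)
    have "B r a = B k a - M * B t a"
      by (simp add: kr bil_lin)
    then have 1: "M dvd B r a"
      using rk by simp
    have "N r - N k = M * (- B r t - M * N t)"
      by (simp add: kr nrm_add nrm_smul bil_lin power2_eq_square algebra_simps)
    then have 2: "M dvd N r - N k"
      by simp
    have mult: "all_dvd d n (u + smul M t) \<longleftrightarrow> all_dvd d n u" if "d dvd M" for d u
    proof -
      have "all_dvd d n (smul M t)"
        using all_dvd_smul_left[OF that] .
      then show ?thesis
        using all_dvd_add[of d n u "smul M t"] all_dvd_add[of d n "u + smul M t" "- smul M t"]
        by (auto simp: all_dvd_minus)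
    qed
    have "all_dvd (N k) n r"
      using mult[OF M(3)[OF root_norm[OF rk(1)]], of r] rk(1) kr by (simp add: iroot_def)
    then have *: "N k = N a \<and> all_dvd (2 * N k) n (a + r)"
      using 1 2 root_norm[OF rk(1)] M(1) unfolding r_def by (intro *) simp_all
    then have "all_dvd (2 * N a) n (a + k)"
      using mult[OF M(2), of "a + r"] by (metis kr add.assoc)
    moreover have "N (a + k) = 2 * N a"
      using rk * by (simp add: nrm_add bil_commute[of n b a])
    ultimately have "root (a + k)"
      using root_pos[OF a] by (simp add: iroot_def)
    then show False
      using k * by (simp add: strongly_orthogonal_def)
  qed
  then show ?thesis
    unfolding Zs_re_emb[OF a] by auto
qed

text \<open>
  If \<open>D k = x g - y h\<close> with \<open>x, y \<ge> 0\<close>, then \<open>x u + y v = 2 D\<close> with positive integers \<open>u, v\<close>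
  (the pairings of \<open>g\<close> and \<open>- h\<close> with the coroot of \<open>k\<close>), so \<open>k\<close> is among the enumerated
  candidates.  If \<open>D k = x g + y h\<close> with \<open>x, y \<ge> 0\<close>, then \<open>N k > 0\<close> makes \<open>k\<close> pair positively with
  \<open>g\<close> or \<open>h\<close>, and the reflection in that root lowers \<open>x + y\<close> or leads to the first case, up to the sign of the root.
  Conversely strong orthogonality to \<open>a\<close> is preserved by the reflections in \<open>g\<close> and \<open>h\<close>, as they
  fix \<open>a\<close>.
\<close>
lemma reflection_check_sound:
  assumes a: "root a" and check: "reflection_check n b a g h p q"
  shows "is_basis_Zs_re G (emb a) {emb g, emb h}"
    "pairing G (emb g) (emb h) = - of_int p" "pairing G (emb h) (emb g) = - of_int q"
proof -
  define D where "D = \<bar>det3 a g h\<bar>"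
  have pq: "D > 0" "p > 0" "q > 0" "B g h = - p * N h" "B g h = - q * N g"
    and g: "inZ a g" and h: "inZ a h" and pos: "nonneg3 g" "nonneg3 h"
    and *: "\<And>x y. x \<in> {0..2 * D} \<Longrightarrow> y \<in> {0..2 * D - x} \<Longrightarrow>
        (let v = smul x g - smul y h; k = sdiv v D in
        if smul D k = v then inZ a k \<longrightarrow> k \<in> {g, - g, h, - h} else True)"
    using check unfolding reflection_check_def Let_def list_all_iff D_def[symmetric] set_upto
    by meson+
  have rg: "root g" "B g a = 0" and rh: "root h" "B h a = 0"
    using g h by (auto simp: strongly_orthogonal_def)
  show pair: "pairing G (emb g) (emb h) = - of_int p" "pairing G (emb h) (emb g) = - of_int q"
  proof -
    have "pairing G (emb g) (emb h) = of_int (- p * N h) / of_int (N h)"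
      "pairing G (emb h) (emb g) = of_int (- q * N g) / of_int (N g)"
      by (simp_all only: pairing_emb bil_commute[of n b h g] flip: pq(4,5))
    then show "pairing G (emb g) (emb h) = - of_int p" "pairing G (emb h) (emb g) = - of_int q"
      using root_pos[OF rg(1)] root_pos[OF rh(1)] by simp_all
  qed
  let ?\<Gamma> = "{emb g, emb h}"
  define orb where "orb = {w \<gamma> | w \<gamma>. w \<in> reflection_group G ?\<Gamma> \<and> \<gamma> \<in> ?\<Gamma>}"
  have orb_base: "x \<in> orb" if "x \<in> ?\<Gamma>" for x
  proof -
    have "x = id x \<and> id \<in> reflection_group G ?\<Gamma> \<and> x \<in> ?\<Gamma>"
      using that reflection_group.one by simp
    then show ?thesis
      unfolding orb_def by blast
  qed
  have orb_elim: "\<exists>w r. w \<in> reflection_group G ?\<Gamma> \<and> r \<in> {g, h} \<and> x = w (emb r)"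
    if "x \<in> orb" for x
    using that unfolding orb_def by blast
  have orb_s: "emb k \<in> orb" if rgh: "r \<in> {g, h}" and srk: "emb (s r k) \<in> orb" for r k
  proof -
    obtain w \<gamma> where w: "w \<in> reflection_group G ?\<Gamma>" "\<gamma> \<in> ?\<Gamma>" "emb (s r k) = w \<gamma>"
      using srk by (auto simp: orb_def)
    have r: "root r" "emb r \<in> ?\<Gamma>"
      using rgh rg rh by auto
    have "emb k = (reflection G (emb r) \<circ> w) \<gamma>"
      using emb_s[OF r(1), of "s r k"] s_s[OF r(1)] w(3) by simp
    moreover have "reflection G (emb r) \<circ> w \<in> reflection_group G ?\<Gamma>"
      using r(2) w(1) by (intro reflection_group.mult reflection_group.gen)
    ultimately show ?thesis
      unfolding orb_def using w(2) by blast
  qed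
  have orb_minus: "- x \<in> orb" if x: "x \<in> orb" for x
  proof -
    obtain w r where w: "w \<in> reflection_group G ?\<Gamma>" "r \<in> {g, h}" "x = w (emb r)"
      using orb_elim[OF x] by blast
    have r: "root r" "emb r \<in> ?\<Gamma>"
      using w(2) rg rh by auto
    have "reflection G (emb r) (emb r) = - emb r"
      using root_pos[OF r(1)] by (simp add: reflection_def pairing_emb bil_self scaleR_2)
    then have "- x = (w \<circ> reflection G (emb r)) (emb r)"
      using w(3) linear_neg[OF linear_reflection_group[OF w(1)]] by simp
    moreover have "w \<circ> reflection G (emb r) \<in> reflection_group G ?\<Gamma>"
      using r(2) w(1) by (intro reflection_group.mult reflection_group.gen)
    ultimately show ?thesis
      unfolding orb_def using r(2) by blast
  qed
  \<comment> \<open>Roots whose coefficients with respect to \<open>g\<close> and \<open>h\<close> have opposite signs.\<close>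
  have mixed: "emb k \<in> orb"
    if k: "inZ a k" and xy: "smul D k = smul x g - smul y h" "x \<ge> 0" "y \<ge> 0" for k x y
  proof -
    have rk: "root k" "N k > 0"
      using k root_pos by (auto simp: strongly_orthogonal_def)
    have B: "D * B k g = 2 * x * N g + y * (q * N g)" "D * B k h = - (x * (p * N h)) - 2 * y * N h"
      using arg_cong[OF xy(1), of "\<lambda>v. B v g"] arg_cong[OF xy(1), of "\<lambda>v. B v h"] pq
      by (simp_all add: bil_lin bil_self bil_commute[of n b h g])
    obtain u where u: "B k g = N k * u"
      using root_dvd(1)[OF rk(1)] by (meson dvdE)
    obtain v where v: "B k h = N k * - v"
      using root_dvd(1)[OF rk(1), of h] by (metis dvdE minus_minus)
    have "D * (2 * N k) = B (smul D k) k"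
      by (simp add: bil_lin bil_self)
    also have "\<dots> = N k * (x * u + y * v)"
      unfolding xy by (simp add: bil_lin bil_commute[of n b _ k] u v algebra_simps)
    finally have sum: "x * u + y * v = 2 * D"
      using rk by simp
    have "0 < x \<or> 0 < y"
      using sum pq xy by (cases "x = 0"; cases "y = 0") auto
    moreover have "x * N g \<ge> 0" "y * (q * N g) \<ge> 0" "x * (p * N h) \<ge> 0" "y * N h \<ge> 0"
      "x > 0 \<Longrightarrow> x * N g > 0" "y > 0 \<Longrightarrow> y * (q * N g) > 0"
      "x > 0 \<Longrightarrow> x * (p * N h) > 0" "y > 0 \<Longrightarrow> y * N h > 0"
      using xy pq root_pos[OF rg(1)] root_pos[OF rh(1)] by simp_all
    ultimately have "D * B k g > 0" "D * B k h < 0"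
      unfolding B by linarith+
    then have "u > 0" "v > 0"
      using pq(1) rk(2) by (auto simp: u v zero_less_mult_iff mult_less_0_iff)
    then have "x * u \<ge> x" "y * v \<ge> y"
      using xy by (simp_all add: mult_le_cancel_left1)
    then have "x \<in> {0..2 * D}" "y \<in> {0..2 * D - x}"
      using sum xy by auto
    from *[OF this] have "k \<in> {g, - g, h, - h}"
      using k sdiv_eq[OF _ xy(1)] pq(1) xy(1) by (simp add: Let_def)
    then show ?thesis
      using orb_base orb_minus by (auto simp: emb_lin)
  qed
  \<comment> \<open>Roots in the cone spanned by \<open>g\<close> and \<open>h\<close>, by descent on the sum of the coefficients.\<close>
  have cone: "emb k \<in> orb"
    if "inZ a k" "smul D k = smul x g + smul y h" "x \<ge> 0" "y \<ge> 0" for k x y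
    using that
  proof (induction "nat (x + y)" arbitrary: k x y rule: less_induct)
    case less
    have k: "root k" "N k > 0"
      using less(2) root_pos by (auto simp: strongly_orthogonal_def)
    have "D * (2 * N k) = B (smul D k) k"
      by (simp add: bil_lin bil_self)
    also have "\<dots> = x * B k g + y * B k h"
      unfolding less(3) by (simp add: bil_lin bil_commute[of n b _ k])
    finally have "x * B k g + y * B k h > 0"
      using k pq(1) by (metis mult_pos_pos zero_less_numeral)
    then have "B k g > 0 \<or> B k h > 0"
      using less(4,5) by (smt (verit) mult_nonneg_nonpos)
    then show ?case
    proof
      assume "B k g > 0"
      obtain c where c: "B k g = c * N g" "s g k = k - smul c g"
        by (rule s_eq[OF rg(1)])
      have "c > 0"
        using \<open>B k g > 0\<close> root_pos[OF rg(1)] by (simp add: c zero_less_mult_iff)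
      have eq: "smul D (s g k) = smul (x - D * c) g + smul y h"
        using less(3) unfolding c(2) by (cases k; cases g; cases h) (simp add: algebra_simps)
      have "emb (s g k) \<in> orb"
      proof (cases "x - D * c \<ge> 0")
        case True
        have "D * c > 0"
          using pq(1) \<open>c > 0\<close> by simp
        then show ?thesis
          using less(1)[OF _ strongly_orthogonal_s[OF g less(2)] eq True less(5)] less(4,5) True by simp
      next
        case False
        have eq': "smul D (- s g k) = smul (- (x - D * c)) g - smul y h"
          unfolding smul_minus eq by (cases g; cases h) (simp add: algebra_simps)
        have "inZ a (- s g k)"
          using strongly_orthogonal_s[OF g less(2)] strongly_orthogonal_minus[OF a] by blast
        then have "emb (- s g k) \<in> orb"
          using mixed[OF _ eq' _ less(5)] False by simp
        then show ?thesis
          using orb_minus[of "emb (- s g k)"] by (simp add: emb_lin)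
      qed
      then show ?thesis
        using orb_s[of g k] by blast
    next
      assume "B k h > 0"
      obtain c where c: "B k h = c * N h" "s h k = k - smul c h"
        by (rule s_eq[OF rh(1)])
      have "c > 0"
        using \<open>B k h > 0\<close> root_pos[OF rh(1)] by (simp add: c zero_less_mult_iff)
      have eq: "smul D (s h k) = smul x g + smul (y - D * c) h"
        using less(3) unfolding c(2) by (cases k; cases g; cases h) (simp add: algebra_simps)
      have "emb (s h k) \<in> orb"
      proof (cases "y - D * c \<ge> 0")
        case True
        have "D * c > 0"
          using pq(1) \<open>c > 0\<close> by simp
        then show ?thesis
          using less(1)[OF _ strongly_orthogonal_s[OF h less(2)] eq less(4) True] less(4,5) True by simp
      next
        case False
        have eq': "smul D (s h k) = smul x g - smul (- (y - D * c)) h"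
          unfolding eq by (cases g; cases h) (simp add: algebra_simps)
        then show ?thesis
          using mixed[OF strongly_orthogonal_s[OF h less(2)] eq' less(4)] False by simp
      qed
      then show ?thesis
        using orb_s[of h k] by blast
    qed
  qed
  have all: "emb k \<in> orb" if k: "inZ a k" for k
  proof -
    have "smul (det3 a g h) k = smul (det3 a k h) g + smul (det3 a g k) h"
      using k rg rh by (intro plane_coordinates a) (auto simp: strongly_orthogonal_def)
    then obtain x y where xy: "smul D k = smul x g + smul y h"
    proof (cases "det3 a g h \<ge> 0")
      case False
      assume "smul (det3 a g h) k = smul (det3 a k h) g + smul (det3 a g k) h"
      then have "smul D k = smul (- det3 a k h) g + smul (- det3 a g k) h"
        using False unfolding D_def by (cases k; cases g; cases h) (simp add: )
      then show ?thesis
        using that by blast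
    qed (use that D_def in auto)
    have k': "inZ a (- k)"
      using k strongly_orthogonal_minus[OF a] by simp
    have neg: "smul D (- k) = smul (- x) g + smul (- y) h"
      using xy by (cases k; cases g; cases h) simp
    have "emb k \<in> orb \<or> emb (- k) \<in> orb"
    proof (cases "x \<ge> 0"; cases "y \<ge> 0")
      assume "x \<ge> 0" "y \<ge> 0"
      then show ?thesis
        using cone[OF k xy] by blast
    next
      assume "x \<ge> 0" "\<not> y \<ge> 0"
      moreover have "smul D k = smul x g - smul (- y) h"
        using xy by (cases k; cases g; cases h) simp
      ultimately show ?thesis
        using mixed[OF k] by auto
    next
      assume "\<not> x \<ge> 0" "y \<ge> 0"
      moreover have "smul D (- k) = smul (- x) g - smul y h"
        using neg by (cases k; cases g; cases h) simp
      ultimately show ?thesis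
        using mixed[OF k'] by auto
    next
      assume "\<not> x \<ge> 0" "\<not> y \<ge> 0"
      then show ?thesis
        using cone[OF k' neg] by auto
    qed
    then show ?thesis
      using orb_minus[of "emb (- k)"] by (auto simp: emb_lin)
  qed
  have "orb \<subseteq> emb ` {k. inZ a k}"
  proof
    fix x assume "x \<in> orb"
    then obtain w r where w: "w \<in> reflection_group G (emb ` {g, h})" "r \<in> {g, h}" "x = w (emb r)"
      using orb_elim[of x] by auto
    have "\<exists>k'. w (emb r) = emb k' \<and> inZ a k'"
      by (rule reflection_group_emb[OF w(1)]) (use w(2) g h rg(1) rh(1) strongly_orthogonal_s in blast)+
    then show "x \<in> emb ` {k. inZ a k}"
      using w(3) by auto
  qed
  then have Zs: "Zs_re G (emb a) = orb"
    unfolding Zs_re_emb[OF a] using all by (intro equalityI image_subsetI) simp_all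
  have ne: "g \<noteq> h"
    using pq(1) by (cases a; cases g) (auto simp: D_def)
  have indep: "of_int k *\<^sub>R emb x = 0"
    if "of_int k *\<^sub>R emb x = real c *\<^sub>R emb y" "det3 a x y \<noteq> 0" for k :: int and c x y
  proof -
    have "emb (smul k x) = emb (smul (int c) y)"
      using that(1) by (simp add: emb_lin)
    then have "smul k x = smul (int c) y"
      by (simp add: emb_inj)
    then have "det3 a (smul k x) y = det3 a (smul (int c) y) y"
      by simp
    then have "k * det3 a x y = 0"
      by (cases a; cases x; cases y) (simp add: algebra_simps)
    then show ?thesis
      using that(2) by simp
  qed
  have swap: "det3 a h g = - det3 a g h"
    by (cases a; cases g; cases h) (simp add: algebra_simps)
  have "weakly_independent ?\<Gamma>"
    using ne pq(1) swap by (intro weakly_independent_pair indep) (auto simp: D_def emb_inj)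
  moreover have "is_GCM (pairing G) ?\<Gamma>"
    using pair pq root_pos[OF rg(1)] root_pos[OF rh(1)]
    by (auto simp: is_GCM_def) (auto simp: pairing_emb bil_self)
  moreover have "\<forall>\<gamma>\<in>?\<Gamma>. \<forall>i. \<gamma> $ i \<ge> 0"
    using pos by (cases g; cases h) (simp add: emb_nonneg)
  moreover have "?\<Gamma> \<subseteq> orb"
    using orb_base by blast
  ultimately show "is_basis_Zs_re G (emb a) ?\<Gamma>"
    unfolding is_basis_Zs_re_def Zs orb_def[symmetric] by blast
qed

end


section \<open>The table\<close>

text \<open>
  Each certificate starts with the number of the simple root \<open>a\<close>.  It continues with a modulus; or two
  isotropic vectors orthogonal to \<open>a\<close>, followed by a root if \<open>Z\<^sub>s(a)\<close> contains one; or the two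
  roots of a basis with their pairings.
\<close>
datatype certificate =
    Congruences int int
  | Null_lines_empty int ivec ivec
  | Null_lines int ivec ivec ivec
  | Reflections int ivec ivec int int

definition simple_root :: "int \<Rightarrow> ivec" where
  "simple_root j = (if j = 1 then (1, 0, 0) else if j = 2 then (0, 1, 0) else (0, 0, 1))"

fun rvec :: "ivec \<Rightarrow> real \<times> real \<times> real" where
  "rvec (x1, x2, x3) = (of_int x1, of_int x2, of_int x3)"

fun index :: "certificate \<Rightarrow> int" where
  "index (Congruences j M) = j"
| "index (Null_lines_empty j e f) = j"
| "index (Null_lines j e f r) = j"
| "index (Reflections j g h p q) = j"

fun valid :: "ivec \<Rightarrow> ivec \<Rightarrow> certificate \<Rightarrow> bool" where
  "valid n b (Congruences j M) \<longleftrightarrow> congruence_check n b (simple_root j) M"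
| "valid n b (Null_lines_empty j e f) \<longleftrightarrow> null_line_check n b (simple_root j) e f []"
| "valid n b (Null_lines j e f r) \<longleftrightarrow> null_line_check n b (simple_root j) e f [r]"
| "valid n b (Reflections j g h p q) \<longleftrightarrow> reflection_check n b (simple_root j) g h p q"

fun certified :: "real ^ 3 ^ 3 \<Rightarrow> certificate \<Rightarrow> bool" where
  "certified G (Congruences j M) \<longleftrightarrow> entry0 G (of_int j)"
| "certified G (Null_lines_empty j e f) \<longleftrightarrow> entry0 G (of_int j)"
| "certified G (Null_lines j e f r) \<longleftrightarrow> entry1 G (of_int j) (rvec r)"
| "certified G (Reflections j g h p q) \<longleftrightarrow>
     entry2 G (of_int j) (rvec g) (rvec h) (of_int p, of_int q)"

lemma fund_simple_root: "j = 1 \<or> j = 2 \<or> j = 3 \<Longrightarrow> fund (of_int j) = emb (simple_root j)"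
  by (auto simp: fund_emb simple_root_def)

lemma vec3_rvec: "vec3 (rvec x) = emb x"
  by (cases x) (simp add: emb.simps)

lemma certified_if_valid:
  assumes "hyperbolic_data n b" and "1 \<le> index c" "index c \<le> 3" and "valid n b c"
  shows "certified (int_gram n b) c"
proof -
  interpret hyperbolic_lattice n b
    by unfold_locales (rule assms)
  have root: "root (simple_root j)" for j
    by (rule root_unit) (simp add: simple_root_def units_def)
  have "index c = 1 \<or> index c = 2 \<or> index c = 3"
    using assms by linarith
  then show ?thesis
    using assms(4) null_line_check_sound[OF root] congruence_check_sound[OF root]
      reflection_check_sound[OF root]
    by (cases c)
      (simp_all add: fund_simple_root vec3_rvec entry0_def entry1_def entry2_def emb_lin insert_commute del: vec3.simps)
qed

definition table :: "(ivec \<times> ivec \<times> certificate list) list" where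
  "table = [
    ((2, 1, 2), (2, 2, 2),
     [Reflections 1 (1, 2, 0) (3, 2, 4) 10 10,
      Congruences 2 6]),
    ((1, 2, 1), (2, 1, 2),
     [Congruences 1 6,
      Reflections 2 (2, 1, 0) (0, 1, 2) 4 4]),
    ((3, 1, 3), (3, 3, 3),
     [Reflections 1 (1, 2, 0) (3, 2, 4) 34 34,
      Reflections 2 (2, 3, 0) (0, 3, 2) 10 10]),
    ((1, 3, 1), (3, 1, 3),
     [Reflections 1 (3, 2, 0) (9, 2, 12) 34 34,
      Reflections 2 (2, 1, 0) (0, 1, 2) 10 10]),
    ((6, 2, 1), (6, 0, 2),
     [Reflections 1 (0, 0, 1) (1, 2, 0) 2 4,
      Reflections 2 (0, 1, 2) (2, 3, 0) 2 6,
      Reflections 3 (1, 0, 0) (1, 6, 6) 4 4]),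
    ((1, 3, 6), (3, 0, 6),
     [Reflections 1 (0, 0, 1) (3, 2, 0) 4 2,
      Reflections 2 (2, 1, 0) (2, 3, 2) 10 10,
      Reflections 3 (1, 0, 0) (0, 2, 1) 1 6]),
    ((3, 1, 2), (3, 0, 2),
     [Reflections 1 (0, 0, 1) (1, 2, 0) 4 2,
      Reflections 2 (2, 3, 0) (2, 9, 6) 10 10,
      Reflections 3 (1, 0, 0) (0, 2, 1) 3 2]),
    ((2, 6, 3), (6, 0, 6),
     [Reflections 1 (0, 0, 1) (3, 2, 0) 2 4,
      Reflections 2 (2, 1, 0) (0, 1, 2) 2 6,
      Reflections 3 (1, 0, 0) (1, 2, 2) 4 4]),
    ((9, 3, 1), (9, 0, 3),
     [Reflections 1 (0, 0, 1) (1, 2, 0) 2 6,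
      Reflections 2 (0, 1, 2) (2, 3, 0) 2 18,
      Reflections 3 (1, 0, 0) (0, 2, 3) 6 2]),
    ((3, 1, 3), (3, 0, 3),
     [Reflections 1 (0, 0, 1) (1, 2, 0) 6 2,
      Reflections 2 (2, 3, 0) (0, 3, 2) 6 6]),
    ((1, 3, 1), (3, 0, 3),
     [Reflections 1 (0, 0, 1) (3, 2, 0) 2 6,
      Reflections 2 (2, 1, 0) (0, 1, 2) 6 6]),
    ((1, 1, 1), (1, 2, 1),
     [Null_lines_empty 2 (3, 2, 1) (1, 2, 3)]),
    ((1, 1, 1), (1, 2, 2),
     [Null_lines_empty 1 (3, 4, 1) (1, 0, 1),
      Null_lines_empty 3 (1, 0, 1) (0, 1, 1)]),
    ((1, 1, 4), (1, 4, 4),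
     [Null_lines_empty 1 (6, 8, 1) (2, 0, 1),
      Null_lines_empty 3 (2, 0, 1) (0, 2, 1)]),
    ((4, 4, 1), (4, 4, 4),
     [Null_lines_empty 1 (3, 4, 2) (1, 0, 2),
      Null_lines_empty 3 (1, 0, 2) (0, 1, 2)]),
    ((2, 4, 1), (4, 2, 4),
     [Reflections 1 (1, 0, 2) (7, 6, 2) 34 34,
      Null_lines 2 (8, 5, 2) (0, 1, 2) (2, 1, 0),
      Null_lines_empty 3 (8, 1, 10) (0, 1, 2)]),
    ((2, 1, 2), (2, 4, 2),
     [Null_lines 1 (5, 8, 1) (1, 0, 1) (1, 2, 0),
      Congruences 2 4]),
    ((1, 2, 1), (2, 2, 2),
     [Null_lines_empty 1 (5, 4, 1) (1, 0, 1),
      Reflections 2 (2, 1, 0) (0, 1, 2) 6 6]),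
    ((1, 1, 1), (2, 2, 2),
     [Null_lines_empty 1 (1, 1, 0) (1, 0, 1)]),
    ((3, 3, 1), (6, 3, 3),
     [Null_lines 1 (1, 1, 0) (13, 1, 24) (1, 0, 2),
      Reflections 3 (2, 0, 3) (0, 2, 3) 14 14]),
    ((1, 1, 3), (2, 3, 3),
     [Null_lines 1 (1, 1, 0) (13, 1, 8) (3, 0, 2),
      Reflections 3 (2, 0, 1) (0, 2, 1) 14 14]),
    ((4, 4, 1), (8, 4, 4),
     [Null_lines_empty 1 (1, 1, 0) (1, 0, 2),
      Null_lines_empty 3 (1, 0, 2) (0, 1, 2)]),
    ((1, 1, 4), (2, 4, 4),
     [Null_lines_empty 1 (1, 1, 0) (2, 0, 1),
      Null_lines_empty 3 (2, 0, 1) (0, 2, 1)]),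
    ((1, 1, 1), (2, 0, 1),
     [Null_lines 1 (1, 1, 0) (1, 1, 1) (0, 0, 1),
      Null_lines 3 (3, 2, 1) (1, 2, 1) (1, 0, 0)]),
    ((1, 4, 4), (4, 0, 4),
     [Null_lines 1 (2, 1, 0) (2, 1, 1) (0, 0, 1),
      Null_lines 3 (6, 2, 1) (2, 2, 1) (1, 0, 0)]),
    ((4, 1, 1), (4, 0, 1),
     [Null_lines 1 (1, 2, 0) (1, 2, 2) (0, 0, 1),
      Null_lines 3 (3, 4, 2) (1, 4, 2) (1, 0, 0)]),
    ((1, 1, 2), (2, 0, 2),
     [Null_lines 1 (1, 1, 0) (1, 1, 1) (0, 0, 1),
      Null_lines_empty 2 (1, 1, 0) (1, 3, 2),
      Reflections 3 (1, 0, 0) (0, 2, 1) 2 4]),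
    ((2, 2, 1), (4, 0, 2),
     [Null_lines 1 (1, 1, 0) (1, 1, 2) (0, 0, 1),
      Null_lines 2 (1, 1, 0) (1, 3, 4) (0, 1, 2),
      Reflections 3 (1, 0, 0) (1, 4, 4) 6 6]),
    ((8, 4, 1), (8, 0, 4),
     [Reflections 1 (0, 0, 1) (1, 2, 0) 1 8,
      Null_lines_empty 2 (2, 3, 2) (0, 1, 2),
      Null_lines 3 (1, 1, 2) (0, 1, 2) (1, 0, 0)]),
    ((1, 2, 8), (2, 0, 8),
     [Reflections 1 (0, 0, 1) (8, 8, 1) 6 6,
      Null_lines 2 (8, 6, 1) (0, 2, 1) (2, 1, 0),
      Null_lines 3 (4, 2, 1) (0, 2, 1) (1, 0, 0)]),
    ((4, 1, 2), (4, 0, 2),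
     [Null_lines 1 (1, 2, 0) (1, 2, 2) (0, 0, 1),
      Null_lines_empty 2 (1, 2, 0) (1, 6, 4),
      Reflections 3 (1, 0, 0) (0, 2, 1) 4 2]),
    ((1, 4, 2), (4, 0, 4),
     [Null_lines 1 (2, 1, 0) (2, 1, 2) (0, 0, 1),
      Null_lines 2 (2, 1, 0) (2, 3, 4) (0, 1, 2),
      Reflections 3 (1, 0, 0) (1, 2, 2) 6 6]),
    ((1, 1, 1), (2, 0, 2),
     [Null_lines 1 (1, 1, 0) (1, 1, 2) (0, 0, 1),
      Null_lines_empty 2 (1, 1, 0) (0, 1, 1)]),
    ((3, 3, 1), (6, 0, 3),
     [Null_lines 1 (1, 1, 0) (1, 1, 3) (0, 0, 1),
      Null_lines 2 (1, 1, 0) (1, 7, 12) (0, 1, 2),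
      Reflections 3 (1, 0, 0) (0, 2, 3) 4 4]),
    ((1, 1, 3), (2, 0, 3),
     [Null_lines 1 (1, 1, 0) (1, 1, 1) (0, 0, 1),
      Null_lines 2 (1, 1, 0) (1, 7, 4) (0, 3, 2),
      Reflections 3 (1, 0, 0) (0, 2, 1) 4 4]),
    ((4, 4, 1), (8, 0, 4),
     [Null_lines 1 (1, 1, 0) (1, 1, 4) (0, 0, 1),
      Null_lines_empty 2 (1, 1, 0) (0, 1, 2),
      Null_lines 3 (2, 1, 2) (0, 1, 2) (1, 0, 0)]),
    ((1, 1, 4), (2, 0, 4),
     [Null_lines 1 (1, 1, 0) (1, 1, 1) (0, 0, 1),
      Null_lines_empty 2 (1, 1, 0) (0, 2, 1),
      Null_lines 3 (4, 2, 1) (0, 2, 1) (1, 0, 0)]),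
    ((1, 4, 12), (4, 0, 12),
     [Null_lines 1 (2, 1, 0) (2, 1, 1) (0, 0, 1),
      Null_lines 2 (2, 1, 0) (2, 7, 4) (0, 3, 2),
      Reflections 3 (1, 0, 0) (0, 2, 1) 2 8]),
    ((12, 3, 1), (12, 0, 3),
     [Null_lines 1 (1, 2, 0) (1, 2, 6) (0, 0, 1),
      Null_lines 2 (1, 2, 0) (1, 14, 24) (0, 1, 2),
      Reflections 3 (1, 0, 0) (0, 2, 3) 8 2]),
    ((3, 1, 4), (3, 0, 4),
     [Reflections 1 (0, 0, 1) (1, 2, 0) 8 2,
      Null_lines 2 (8, 14, 1) (0, 2, 1) (2, 3, 0),
      Null_lines 3 (2, 2, 1) (0, 2, 1) (1, 0, 0)]),
    ((4, 12, 3), (12, 0, 12),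
     [Reflections 1 (0, 0, 1) (3, 2, 0) 2 8,
      Null_lines 2 (12, 7, 2) (0, 1, 2) (2, 1, 0),
      Null_lines 3 (3, 1, 2) (0, 1, 2) (1, 0, 0)]),
    ((16, 4, 1), (16, 0, 4),
     [Null_lines 1 (1, 2, 0) (1, 2, 8) (0, 0, 1),
      Null_lines_empty 2 (1, 2, 0) (0, 1, 2),
      Null_lines 3 (1, 1, 2) (0, 1, 2) (1, 0, 0)]),
    ((4, 1, 4), (4, 0, 4),
     [Null_lines 1 (1, 2, 0) (1, 2, 2) (0, 0, 1),
      Null_lines_empty 2 (1, 2, 0) (0, 2, 1)]),
    ((1, 4, 1), (4, 0, 4),
     [Null_lines 1 (2, 1, 0) (2, 1, 4) (0, 0, 1),
      Null_lines_empty 2 (2, 1, 0) (0, 1, 2)])]"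

lemma table_valid:
  "list_all (\<lambda>(n, b, cs). hyperbolic_data n b \<and>
     list_all (\<lambda>c. 1 \<le> index c \<and> index c \<le> 3 \<and> valid n b c) cs) table"
  by code_simp

lemma table_certified:
  "list_all (\<lambda>(n, b, cs). hyperbolic (int_gram n b) \<and> list_all (certified (int_gram n b)) cs) table"
  using table_valid hyperbolic_int_gram certified_if_valid
  by (fastforce simp: list_all_iff)

theorem mainTheorem2:
  shows "
    (let \<Phi> = gram (2, 1, 2) (2, 2, 2) in
      hyperbolic \<Phi> \<and>
      entry2 \<Phi> 1 (1, 2, 0) (3, 2, 4) (10, 10) \<and>
      entry0 \<Phi> 2) \<and>
    (let \<Phi> = gram (1, 2, 1) (2, 1, 2) in
      hyperbolic \<Phi> \<and>
      entry0 \<Phi> 1 \<and>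
      entry2 \<Phi> 2 (2, 1, 0) (0, 1, 2) (4, 4)) \<and>
    (let \<Phi> = gram (3, 1, 3) (3, 3, 3) in
      hyperbolic \<Phi> \<and>
      entry2 \<Phi> 1 (1, 2, 0) (3, 2, 4) (34, 34) \<and>
      entry2 \<Phi> 2 (2, 3, 0) (0, 3, 2) (10, 10)) \<and>
    (let \<Phi> = gram (1, 3, 1) (3, 1, 3) in
      hyperbolic \<Phi> \<and>
      entry2 \<Phi> 1 (3, 2, 0) (9, 2, 12) (34, 34) \<and>
      entry2 \<Phi> 2 (2, 1, 0) (0, 1, 2) (10, 10)) \<and>
    (let \<Phi> = gram (6, 2, 1) (6, 0, 2) in
      hyperbolic \<Phi> \<and>
      entry2 \<Phi> 1 (0, 0, 1) (1, 2, 0) (2, 4) \<and>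
      entry2 \<Phi> 2 (0, 1, 2) (2, 3, 0) (2, 6) \<and>
      entry2 \<Phi> 3 (1, 0, 0) (1, 6, 6) (4, 4)) \<and>
    (let \<Phi> = gram (1, 3, 6) (3, 0, 6) in
      hyperbolic \<Phi> \<and>
      entry2 \<Phi> 1 (0, 0, 1) (3, 2, 0) (4, 2) \<and>
      entry2 \<Phi> 2 (2, 1, 0) (2, 3, 2) (10, 10) \<and>
      entry2 \<Phi> 3 (1, 0, 0) (0, 2, 1) (1, 6)) \<and>
    (let \<Phi> = gram (3, 1, 2) (3, 0, 2) in
      hyperbolic \<Phi> \<and>
      entry2 \<Phi> 1 (0, 0, 1) (1, 2, 0) (4, 2) \<and>
      entry2 \<Phi> 2 (2, 3, 0) (2, 9, 6) (10, 10) \<and>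
      entry2 \<Phi> 3 (1, 0, 0) (0, 2, 1) (3, 2)) \<and>
    (let \<Phi> = gram (2, 6, 3) (6, 0, 6) in
      hyperbolic \<Phi> \<and>
      entry2 \<Phi> 1 (0, 0, 1) (3, 2, 0) (2, 4) \<and>
      entry2 \<Phi> 2 (2, 1, 0) (0, 1, 2) (2, 6) \<and>
      entry2 \<Phi> 3 (1, 0, 0) (1, 2, 2) (4, 4)) \<and>
    (let \<Phi> = gram (9, 3, 1) (9, 0, 3) in
      hyperbolic \<Phi> \<and>
      entry2 \<Phi> 1 (0, 0, 1) (1, 2, 0) (2, 6) \<and>
      entry2 \<Phi> 2 (0, 1, 2) (2, 3, 0) (2, 18) \<and>
      entry2 \<Phi> 3 (1, 0, 0) (0, 2, 3) (6, 2)) \<and>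
    (let \<Phi> = gram (3, 1, 3) (3, 0, 3) in
      hyperbolic \<Phi> \<and>
      entry2 \<Phi> 1 (0, 0, 1) (1, 2, 0) (6, 2) \<and>
      entry2 \<Phi> 2 (2, 3, 0) (0, 3, 2) (6, 6)) \<and>
    (let \<Phi> = gram (1, 3, 1) (3, 0, 3) in
      hyperbolic \<Phi> \<and>
      entry2 \<Phi> 1 (0, 0, 1) (3, 2, 0) (2, 6) \<and>
      entry2 \<Phi> 2 (2, 1, 0) (0, 1, 2) (6, 6)) \<and>
    (let \<Phi> = gram (1, 1, 1) (1, 2, 1) in
      hyperbolic \<Phi> \<and>
      entry0 \<Phi> 2) \<and>
    (let \<Phi> = gram (1, 1, 1) (1, 2, 2) in
      hyperbolic \<Phi> \<and>
      entry0 \<Phi> 1 \<and>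
      entry0 \<Phi> 3) \<and>
    (let \<Phi> = gram (1, 1, 4) (1, 4, 4) in
      hyperbolic \<Phi> \<and>
      entry0 \<Phi> 1 \<and>
      entry0 \<Phi> 3) \<and>
    (let \<Phi> = gram (4, 4, 1) (4, 4, 4) in
      hyperbolic \<Phi> \<and>
      entry0 \<Phi> 1 \<and>
      entry0 \<Phi> 3) \<and>
    (let \<Phi> = gram (2, 4, 1) (4, 2, 4) in
      hyperbolic \<Phi> \<and>
      entry2 \<Phi> 1 (1, 0, 2) (7, 6, 2) (34, 34) \<and>
      entry1 \<Phi> 2 (2, 1, 0) \<and>
      entry0 \<Phi> 3) \<and>
    (let \<Phi> = gram (2, 1, 2) (2, 4, 2) in
      hyperbolic \<Phi> \<and>
      entry1 \<Phi> 1 (1, 2, 0) \<and>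
      entry0 \<Phi> 2) \<and>
    (let \<Phi> = gram (1, 2, 1) (2, 2, 2) in
      hyperbolic \<Phi> \<and>
      entry0 \<Phi> 1 \<and>
      entry2 \<Phi> 2 (2, 1, 0) (0, 1, 2) (6, 6)) \<and>
    (let \<Phi> = gram (1, 1, 1) (2, 2, 2) in
      hyperbolic \<Phi> \<and>
      entry0 \<Phi> 1) \<and>
    (let \<Phi> = gram (3, 3, 1) (6, 3, 3) in
      hyperbolic \<Phi> \<and>
      entry1 \<Phi> 1 (1, 0, 2) \<and>
      entry2 \<Phi> 3 (2, 0, 3) (0, 2, 3) (14, 14)) \<and>
    (let \<Phi> = gram (1, 1, 3) (2, 3, 3) in
      hyperbolic \<Phi> \<and>
      entry1 \<Phi> 1 (3, 0, 2) \<and>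
      entry2 \<Phi> 3 (2, 0, 1) (0, 2, 1) (14, 14)) \<and>
    (let \<Phi> = gram (4, 4, 1) (8, 4, 4) in
      hyperbolic \<Phi> \<and>
      entry0 \<Phi> 1 \<and>
      entry0 \<Phi> 3) \<and>
    (let \<Phi> = gram (1, 1, 4) (2, 4, 4) in
      hyperbolic \<Phi> \<and>
      entry0 \<Phi> 1 \<and>
      entry0 \<Phi> 3) \<and>
    (let \<Phi> = gram (1, 1, 1) (2, 0, 1) in
      hyperbolic \<Phi> \<and>
      entry1 \<Phi> 1 (0, 0, 1) \<and>
      entry1 \<Phi> 3 (1, 0, 0)) \<and>
    (let \<Phi> = gram (1, 4, 4) (4, 0, 4) in
      hyperbolic \<Phi> \<and>
      entry1 \<Phi> 1 (0, 0, 1) \<and>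
      entry1 \<Phi> 3 (1, 0, 0)) \<and>
    (let \<Phi> = gram (4, 1, 1) (4, 0, 1) in
      hyperbolic \<Phi> \<and>
      entry1 \<Phi> 1 (0, 0, 1) \<and>
      entry1 \<Phi> 3 (1, 0, 0)) \<and>
    (let \<Phi> = gram (1, 1, 2) (2, 0, 2) in
      hyperbolic \<Phi> \<and>
      entry1 \<Phi> 1 (0, 0, 1) \<and>
      entry0 \<Phi> 2 \<and>
      entry2 \<Phi> 3 (1, 0, 0) (0, 2, 1) (2, 4)) \<and>
    (let \<Phi> = gram (2, 2, 1) (4, 0, 2) in
      hyperbolic \<Phi> \<and>
      entry1 \<Phi> 1 (0, 0, 1) \<and>
      entry1 \<Phi> 2 (0, 1, 2) \<and>
      entry2 \<Phi> 3 (1, 0, 0) (1, 4, 4) (6, 6)) \<and>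
    (let \<Phi> = gram (8, 4, 1) (8, 0, 4) in
      hyperbolic \<Phi> \<and>
      entry2 \<Phi> 1 (0, 0, 1) (1, 2, 0) (1, 8) \<and>
      entry0 \<Phi> 2 \<and>
      entry1 \<Phi> 3 (1, 0, 0)) \<and>
    (let \<Phi> = gram (1, 2, 8) (2, 0, 8) in
      hyperbolic \<Phi> \<and>
      entry2 \<Phi> 1 (0, 0, 1) (8, 8, 1) (6, 6) \<and>
      entry1 \<Phi> 2 (2, 1, 0) \<and>
      entry1 \<Phi> 3 (1, 0, 0)) \<and>
    (let \<Phi> = gram (4, 1, 2) (4, 0, 2) in
      hyperbolic \<Phi> \<and>
      entry1 \<Phi> 1 (0, 0, 1) \<and>
      entry0 \<Phi> 2 \<and>
      entry2 \<Phi> 3 (1, 0, 0) (0, 2, 1) (4, 2)) \<and>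
    (let \<Phi> = gram (1, 4, 2) (4, 0, 4) in
      hyperbolic \<Phi> \<and>
      entry1 \<Phi> 1 (0, 0, 1) \<and>
      entry1 \<Phi> 2 (0, 1, 2) \<and>
      entry2 \<Phi> 3 (1, 0, 0) (1, 2, 2) (6, 6)) \<and>
    (let \<Phi> = gram (1, 1, 1) (2, 0, 2) in
      hyperbolic \<Phi> \<and>
      entry1 \<Phi> 1 (0, 0, 1) \<and>
      entry0 \<Phi> 2) \<and>
    (let \<Phi> = gram (3, 3, 1) (6, 0, 3) in
      hyperbolic \<Phi> \<and>
      entry1 \<Phi> 1 (0, 0, 1) \<and>
      entry1 \<Phi> 2 (0, 1, 2) \<and>
      entry2 \<Phi> 3 (1, 0, 0) (0, 2, 3) (4, 4)) \<and>
    (let \<Phi> = gram (1, 1, 3) (2, 0, 3) in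
      hyperbolic \<Phi> \<and>
      entry1 \<Phi> 1 (0, 0, 1) \<and>
      entry1 \<Phi> 2 (0, 3, 2) \<and>
      entry2 \<Phi> 3 (1, 0, 0) (0, 2, 1) (4, 4)) \<and>
    (let \<Phi> = gram (4, 4, 1) (8, 0, 4) in
      hyperbolic \<Phi> \<and>
      entry1 \<Phi> 1 (0, 0, 1) \<and>
      entry0 \<Phi> 2 \<and>
      entry1 \<Phi> 3 (1, 0, 0)) \<and>
    (let \<Phi> = gram (1, 1, 4) (2, 0, 4) in
      hyperbolic \<Phi> \<and>
      entry1 \<Phi> 1 (0, 0, 1) \<and>
      entry0 \<Phi> 2 \<and>
      entry1 \<Phi> 3 (1, 0, 0)) \<and>
    (let \<Phi> = gram (1, 4, 12) (4, 0, 12) in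
      hyperbolic \<Phi> \<and>
      entry1 \<Phi> 1 (0, 0, 1) \<and>
      entry1 \<Phi> 2 (0, 3, 2) \<and>
      entry2 \<Phi> 3 (1, 0, 0) (0, 2, 1) (2, 8)) \<and>
    (let \<Phi> = gram (12, 3, 1) (12, 0, 3) in
      hyperbolic \<Phi> \<and>
      entry1 \<Phi> 1 (0, 0, 1) \<and>
      entry1 \<Phi> 2 (0, 1, 2) \<and>
      entry2 \<Phi> 3 (1, 0, 0) (0, 2, 3) (8, 2)) \<and>
    (let \<Phi> = gram (3, 1, 4) (3, 0, 4) in
      hyperbolic \<Phi> \<and>
      entry2 \<Phi> 1 (0, 0, 1) (1, 2, 0) (8, 2) \<and>
      entry1 \<Phi> 2 (2, 3, 0) \<and>
      entry1 \<Phi> 3 (1, 0, 0)) \<and>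
    (let \<Phi> = gram (4, 12, 3) (12, 0, 12) in
      hyperbolic \<Phi> \<and>
      entry2 \<Phi> 1 (0, 0, 1) (3, 2, 0) (2, 8) \<and>
      entry1 \<Phi> 2 (2, 1, 0) \<and>
      entry1 \<Phi> 3 (1, 0, 0)) \<and>
    (let \<Phi> = gram (16, 4, 1) (16, 0, 4) in
      hyperbolic \<Phi> \<and>
      entry1 \<Phi> 1 (0, 0, 1) \<and>
      entry0 \<Phi> 2 \<and>
      entry1 \<Phi> 3 (1, 0, 0)) \<and>
    (let \<Phi> = gram (4, 1, 4) (4, 0, 4) in
      hyperbolic \<Phi> \<and>
      entry1 \<Phi> 1 (0, 0, 1) \<and>
      entry0 \<Phi> 2) \<and>
    (let \<Phi> = gram (1, 4, 1) (4, 0, 4) in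
      hyperbolic \<Phi> \<and>
      entry1 \<Phi> 1 (0, 0, 1) \<and>
      entry0 \<Phi> 2)"
  using table_certified
  by (simp only: table_def list.pred_inject prod.case certified.simps int_gram.simps rvec.simps Let_def
      of_int_numeral of_int_1 of_int_0 simp_thms)

end
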